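(* Let $\psi_{jk}^{r,\nu}$ and $\tilde\psi_{jk}^{r,\nu}$ be the spherical wavelet differential $r$-forms on $S^2$ and their duals, as defined in the context. Then for $\nu\in\{\mathrm{d},\delta\}$, i.e. for each $(r,\nu)\in\{(0,\delta),(1,\mathrm{d}),(1,\delta),(2,\mathrm{d})\}$, the family $\{\psi_{jk}^{r,\nu}\}_{j\ge-1,\,k\in\mathcal{K}_j}$ is a (Stevenson) frame for the homogeneous Sobolev space $\dot H^{-r+1}(\Omega_\nu^r,S^2)$, and $\{\tilde\psi_{jk}^{r,\nu}\}_{j\ge-1,\,k\in\mathcal{K}_j}$ is its canonical dual frame in $\dot H^{r-1}(\Omega_\nu^r,S^2)$; in particular $f=\sum_{j,k}\langle\!\langle f,\tilde\psi_{jk}^{r,\nu}\rangle\!\rangle\,\psi_{jk}^{r,\nu}$ for all $f\in\dot H^{-r+1}(\Omega_\nu^r,S^2)$.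
   Context: $S^2$ is the oriented unit sphere with its round metric; differential forms are complex-valued. $\mathrm{d}$ is the exterior derivative, $\star$ the Hodge star of the round metric, $\langle\!\langle\alpha,\beta\rangle\!\rangle=\int_{S^2}\alpha\wedge\star\overline{\beta}$ the $L_2$ inner product of $r$-forms, and $\delta$ the adjoint of $\mathrm{d}$. $\Omega^r_{\mathrm{d}}$, $\Omega^r_\delta$, $\Omega^r_h$ are the spaces of exact, co-exact and harmonic $r$-forms. Spectral form basis: with $y_{lm}$ the standard complex spherical harmonics (orthonormal in $L_2(S^2)$), $y_{00}^{0,\delta}=0$ and $y_{lm}^{0,\delta}=y_{lm}$ for $l\ge1$; for $l\ge 1$, $y_{lm}^{1,\mathrm{d}}=\frac{1}{\sqrt{l(l+1)}}\mathrm{d}y_{lm}$, $y_{lm}^{1,\delta}=-\frac{1}{\sqrt{l(l+1)}}\star\mathrm{d}y_{lm}$, and $y_{00}^{1,\mathrm{d}}=y_{00}^{1,\delta}=0$; $y_{lm}^{2,\mathrm{d}}=\star y_{lm}^{0,\delta}$. For each of these $(r,\nu)$ the forms $y_{lm}^{r,\nu}$, $l\ge1$, are an orthonormal basis of the $L_2$-closure of $\Omega^r_\nu$. Homogeneous Sobolev spaces: for $s\in\mathbb{R}$, $\dot H^s(\Omega_\nu^r,S^2)$ is the Hilbert space of (formal/distributional) expansions $\alpha=\sum_{l\ge1}\sum_{|m|\le l}\alpha_{lm}\,y_{lm}^{r,\nu}$ with $\|\alpha\|_{\dot H^s}^2=\sum_{l\ge 1}\sum_{m=-l}^{l}(l(l+1))^s|\alpha_{lm}|^2<\infty$.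 The spaces $\dot H^{s}$ and $\dot H^{-s}$ are dual to each other through the sesquilinear extension $\langle\!\langle\alpha,\beta\rangle\!\rangle=\sum_{l,m}\alpha_{lm}\overline{\beta_{lm}}$ of the $L_2$ inner product. Wavelet forms: let $L_j<\infty$ ($j\ge-1$) be nonnegative integers, $\kappa_l^j$ numbers with $\kappa^j_l=0$ for $l>L_j$, $\lambda_{jk}\in S^2$, $w_{jk}>0$ ($k\in\mathcal{K}_j$), and $\kappa_{lm}^{jk}=\sqrt{\frac{4\pi}{2l+1}}\sqrt{w_{jk}}\,\kappa_l^j\,y_{lm}(\lambda_{jk})$. It is assumed that the scalar wavelets $\psi_{jk}=\sum_{l=0}^{L_j}\sum_{m=-l}^{l}\kappa_{lm}^{jk}y_{lm}$ ($j\ge-1$, $k\in\mathcal{K}_j$) form a Parseval tight frame for $L_2(S^2)$, and that level $-1$ has a single index $k=0$ with $\kappa_{lm}^{-1,0}=\delta_{l0}$. With $a_l=\sqrt{l(l+1)}$ (and terms with $l=0$ understood as zero), set $\psi_{jk}^{0,\delta}=\sum_{l,m}a_l^{-1}\kappa_{lm}^{jk}y_{lm}^{0,\delta}$, $\ \tilde\psi_{jk}^{0,\delta}=\sum_{l,m}a_l\kappa_{lm}^{jk}y_{lm}^{0,\delta}$; $\psi_{jk}^{1,\mathrm{d}}=\tilde\psi_{jk}^{1,\mathrm{d}}=\sum_{l,m}\kappa_{lm}^{jk}y_{lm}^{1,\mathrm{d}}$, $\ \psi_{jk}^{1,\delta}=\tilde\psi_{jk}^{1,\delta}=\sum_{l,m}\kappa_{lm}^{jk}y_{lm}^{1,\delta}$;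 $\psi_{jk}^{2,\mathrm{d}}=\sum_{l,m}a_l\kappa_{lm}^{jk}y_{lm}^{2,\mathrm{d}}$, $\ \tilde\psi_{jk}^{2,\mathrm{d}}=\sum_{l,m}a_l^{-1}\kappa_{lm}^{jk}y_{lm}^{2,\mathrm{d}}$, where all sums run over $0\le l\le L_j$, $-l\le m\le l$. Stevenson frame: for a Hilbert space $H$ with dual $H'$ (not identified with $H$), a family $(\psi_i)\subset H$ is a Stevenson frame for $H$ if there are $0<A\le B<\infty$ with $A\|g\|_{H'}^2\le\sum_i|\langle g,\psi_i\rangle|^2\le B\|g\|_{H'}^2$ for all $g\in H'$. Its frame operator is $S:H'\to H$, $Sg=\sum_i\langle g,\psi_i\rangle\psi_i$, and its canonical dual frame is $(S^{-1}\psi_i)\subset H'$. Here $H=\dot H^{-r+1}(\Omega^r_\nu,S^2)$ and $H'=\dot H^{r-1}(\Omega^r_\nu,S^2)$ with the pairing above. *)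

theory Defs
  imports "HOL-Analysis.Analysis" "HOL-Computational_Algebra.Polynomial"
begin

section \<open>The round sphere and its spherical harmonics\<close>

abbreviation S2 :: "(real ^ 3) set" where
  "S2 \<equiv> sphere 0 1"

definition spherical_coords :: "real \<Rightarrow> real \<Rightarrow> real ^ 3" where
  "spherical_coords \<theta> \<phi> = vector [sin \<theta> * cos \<phi>, sin \<theta> * sin \<phi>, cos \<theta>]"

text \<open>The area measure of the round metric, \<open>sin \<theta> d\<theta> d\<phi>\<close> in spherical coordinates.\<close>

definition sphere_measure :: "(real ^ 3) measure" where
  "sphere_measure =
     distr (density (restrict_space lborel ({0..pi} \<times> {0..2 * pi})) (\<lambda>(\<theta>, \<phi>). ennreal (sin \<theta>)))
       (restrict_space borel S2) (\<lambda>(\<theta>, \<phi>). spherical_coords \<theta> \<phi>)"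

definition L2_sphere :: "(real ^ 3 \<Rightarrow> complex) set" where
  "L2_sphere = {f \<in> borel_measurable sphere_measure. integrable sphere_measure (\<lambda>p. (cmod (f p))\<^sup>2)}"

definition L2_inner :: "(real ^ 3 \<Rightarrow> complex) \<Rightarrow> (real ^ 3 \<Rightarrow> complex) \<Rightarrow> complex" where
  "L2_inner f g = (LINT p|sphere_measure. f p * cnj (g p))"

definition legendre :: "nat \<Rightarrow> real poly" where
  "legendre l = smult (1 / (2 ^ l * fact l)) ((pderiv ^^ l) ([:-1, 0, 1:] ^ l))"

definition assoc_legendre :: "nat \<Rightarrow> nat \<Rightarrow> real \<Rightarrow> real" where
  "assoc_legendre l m x = (-1) ^ m * sqrt (1 - x\<^sup>2) ^ m * poly ((pderiv ^^ m) (legendre l)) x"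

text \<open>The orthonormal complex spherical harmonics (with Condon--Shortley phase) as functions of a
  point \<open>p\<close> of the sphere: \<open>p $ 3 = cos \<theta>\<close>, and \<open>Arg (Complex (p $ 1) (p $ 2))\<close> is the longitude
  \<open>\<phi>\<close>. (At the poles the choice of the longitude is immaterial: there \<open>assoc_legendre l m\<close>
  vanishes for \<open>m > 0\<close>.)\<close>

definition sph_harm_nonneg :: "nat \<Rightarrow> nat \<Rightarrow> real ^ 3 \<Rightarrow> complex" where
  "sph_harm_nonneg l m p =
     complex_of_real (sqrt ((2 * real l + 1) / (4 * pi) * (fact (l - m) / fact (l + m)))
                      * assoc_legendre l m (p $ 3))
     * cis (real m * Arg (Complex (p $ 1) (p $ 2)))"

definition sph_harm :: "nat \<Rightarrow> int \<Rightarrow> real ^ 3 \<Rightarrow> complex" where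
  "sph_harm l m p =
     (if m \<ge> 0 then sph_harm_nonneg l (nat m) p
      else (-1) ^ nat (- m) * cnj (sph_harm_nonneg l (nat (- m)) p))"

section \<open>Complex-valued differential forms on the sphere\<close>

text \<open>A form is evaluated at a point of the sphere and a list of tangent vectors; an \<open>r\<close>-form
  is zero on lists of length different from \<open>r\<close>. Values at points off the sphere
  or on vectors that are not tangent are junk that no definition below depends on.\<close>

type_synonym form = "real ^ 3 \<Rightarrow> (real ^ 3) list \<Rightarrow> complex"

definition form0 :: "(real ^ 3 \<Rightarrow> complex) \<Rightarrow> form" where
  "form0 f = (\<lambda>p vs. if vs = [] then f p else 0)"

text \<open>The exterior derivative on \<open>0\<close>-forms. The function on the sphere is differentiated after
  extending it to be constant along rays; on tangent vectors this is the intrinsic differential.\<close>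

definition ext_deriv0 :: "(real ^ 3 \<Rightarrow> complex) \<Rightarrow> form" where
  "ext_deriv0 f = (\<lambda>p vs. case vs of
       [v] \<Rightarrow> frechet_derivative (\<lambda>x. f (x /\<^sub>R norm x)) (at p) v
     | _ \<Rightarrow> 0)"

text \<open>Positively oriented orthonormal bases of the tangent plane at \<open>p\<close> (outward orientation).\<close>

definition oriented_frame :: "real ^ 3 \<Rightarrow> (real ^ 3) \<times> (real ^ 3) \<Rightarrow> bool" where
  "oriented_frame p = (\<lambda>(u, v). norm u = 1 \<and> norm v = 1 \<and> u \<bullet> v = 0 \<and> cross3 u v = p)"

text \<open>Hodge star: \<open>\<star>f = f vol\<close> with \<open>vol\<^sub>p(u,v) = p \<bullet> (u \<times> v)\<close>; on a \<open>1\<close>-form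
  \<open>(\<star>\<alpha>)\<^sub>p(v) = -\<alpha>\<^sub>p(p \<times> v)\<close>, where \<open>p \<times> v\<close> is the rotation of \<open>v\<close> by a right angle, so that
  \<open>\<star>e\<^sup>1 = e\<^sup>2\<close> and \<open>\<star>e\<^sup>2 = -e\<^sup>1\<close>; and \<open>\<star>(f vol) = f\<close>.\<close>

definition hodge :: "form \<Rightarrow> form" where
  "hodge \<omega> = (\<lambda>p vs. case vs of
       [] \<Rightarrow> (case (SOME e. oriented_frame p e) of (u, v) \<Rightarrow> \<omega> p [u, v])
     | [v] \<Rightarrow> - \<omega> p [cross3 p v]
     | [u, v] \<Rightarrow> \<omega> p [] * complex_of_real (p \<bullet> cross3 u v)
     | _ \<Rightarrow> 0)"

definition wedge :: "form \<Rightarrow> form \<Rightarrow> form" where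
  "wedge \<alpha> \<beta> = (\<lambda>p vs. case vs of
       [] \<Rightarrow> \<alpha> p [] * \<beta> p []
     | [v] \<Rightarrow> \<alpha> p [] * \<beta> p [v] + \<alpha> p [v] * \<beta> p []
     | [u, v] \<Rightarrow> \<alpha> p [] * \<beta> p [u, v] + \<alpha> p [u] * \<beta> p [v] - \<alpha> p [v] * \<beta> p [u]
                 + \<alpha> p [u, v] * \<beta> p []
     | _ \<Rightarrow> 0)"

text \<open>The integral of a \<open>2\<close>-form \<open>\<omega> = (\<star>\<omega>) vol\<close> over the oriented sphere.\<close>

definition form_integral :: "form \<Rightarrow> complex" where
  "form_integral \<omega> = (LINT p|sphere_measure. hodge \<omega> p [])"

definition form_inner :: "form \<Rightarrow> form \<Rightarrow> complex" where
  "form_inner \<alpha> \<beta> = form_integral (wedge \<alpha> (hodge (\<lambda>p vs. cnj (\<beta> p vs))))"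

section \<open>Spectral basis\<close>

datatype hodge_part = Exact | Coexact

definition spec_a :: "nat \<Rightarrow> real" where
  "spec_a l = sqrt (real l * (real l + 1))"

definition sph_harm0 :: "nat \<Rightarrow> int \<Rightarrow> form" where
  "sph_harm0 l m = form0 (if l = 0 then (\<lambda>p. 0) else sph_harm l m)"

text \<open>The forms \<open>y\<^sub>l\<^sub>m\<close> of degree \<open>r\<close> and type \<open>\<nu>\<close>. There are no nonzero exact \<open>0\<close>-forms
  and no nonzero co-exact \<open>2\<close>-forms; the last clause is for these degrees and for \<open>r > 2\<close>.\<close>

definition spec_form :: "nat \<Rightarrow> hodge_part \<Rightarrow> nat \<Rightarrow> int \<Rightarrow> form" where
  "spec_form r \<nu> l m =
     (if (r, \<nu>) = (0, Coexact) then sph_harm0 l m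
      else if (r, \<nu>) = (1, Exact) then
        (if l = 0 then (\<lambda>p vs. 0)
         else (\<lambda>p vs. complex_of_real (1 / spec_a l) * ext_deriv0 (sph_harm l m) p vs))
      else if (r, \<nu>) = (1, Coexact) then
        (if l = 0 then (\<lambda>p vs. 0)
         else (\<lambda>p vs. - complex_of_real (1 / spec_a l) * hodge (ext_deriv0 (sph_harm l m)) p vs))
      else if (r, \<nu>) = (2, Exact) then hodge (sph_harm0 l m)
      else (\<lambda>p vs. 0))"

section \<open>Homogeneous Sobolev spaces\<close>

text \<open>A formal expansion \<open>\<Sum> \<alpha>\<^sub>l\<^sub>m y\<^sub>l\<^sub>m\<close> over \<open>l \<ge> 1\<close>, \<open>|m| \<le> l\<close> in the basis of degree \<open>r\<close>
  and type \<open>\<nu>\<close> is represented by its coefficients, extended by zero. The set of admissible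
  coefficients does not depend on \<open>(r, \<nu>)\<close>; the basis enters through \<open>expansion r \<nu>\<close> below, which
  assigns to an actual form its coefficients.\<close>

type_synonym coeffs = "nat \<times> int \<Rightarrow> complex"

definition spec_index :: "(nat \<times> int) set" where
  "spec_index = {(l, m). 1 \<le> l \<and> \<bar>m\<bar> \<le> int l}"

definition sobolev_term :: "real \<Rightarrow> coeffs \<Rightarrow> nat \<times> int \<Rightarrow> real" where
  "sobolev_term s \<alpha> = (\<lambda>(l, m). (real l * (real l + 1)) powr s * (cmod (\<alpha> (l, m)))\<^sup>2)"

definition sobolev :: "real \<Rightarrow> coeffs set" where
  "sobolev s = {\<alpha>. (\<forall>i. i \<notin> spec_index \<longrightarrow> \<alpha> i = 0) \<and> sobolev_term s \<alpha> summable_on spec_index}"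

definition sobolev_norm :: "real \<Rightarrow> coeffs \<Rightarrow> real" where
  "sobolev_norm s \<alpha> = sqrt (\<Sum>\<^sub>\<infinity>i\<in>spec_index. sobolev_term s \<alpha> i)"

text \<open>The sesquilinear duality between \<open>sobolev s\<close> and \<open>sobolev (- s)\<close>.\<close>

definition sobolev_pairing :: "coeffs \<Rightarrow> coeffs \<Rightarrow> complex" where
  "sobolev_pairing \<alpha> \<beta> = (\<Sum>\<^sub>\<infinity>i\<in>spec_index. \<alpha> i * cnj (\<beta> i))"

definition expansion :: "nat \<Rightarrow> hodge_part \<Rightarrow> form \<Rightarrow> coeffs" where
  "expansion r \<nu> \<omega> =
     (\<lambda>(l, m). if (l, m) \<in> spec_index then form_inner \<omega> (spec_form r \<nu> l m) else 0)"

text \<open>Unconditional convergence of a series in the norm of \<open>sobolev s\<close>. Membership is required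
  explicitly because \<open>sobolev_norm\<close> is only meaningful on \<open>sobolev s\<close>.\<close>

definition sobolev_has_sum :: "real \<Rightarrow> ('i \<Rightarrow> coeffs) \<Rightarrow> 'i set \<Rightarrow> coeffs \<Rightarrow> bool" where
  "sobolev_has_sum s f I \<alpha> \<longleftrightarrow>
     \<alpha> \<in> sobolev s \<and> (\<forall>i\<in>I. f i \<in> sobolev s) \<and>
     ((\<lambda>F. sobolev_norm s (\<lambda>n. \<alpha> n - (\<Sum>i\<in>F. f i n))) \<longlongrightarrow> 0) (finite_subsets_at_top I)"

section \<open>Frames\<close>

definition parseval_frame :: "'i set \<Rightarrow> ('i \<Rightarrow> real ^ 3 \<Rightarrow> complex) \<Rightarrow> bool" where
  "parseval_frame I \<psi> \<longleftrightarrow>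
     (\<forall>i\<in>I. \<psi> i \<in> L2_sphere) \<and>
     (\<forall>f\<in>L2_sphere.
        ((\<lambda>i. (cmod (L2_inner f (\<psi> i)))\<^sup>2) has_sum (LINT p|sphere_measure. (cmod (f p))\<^sup>2)) I)"

text \<open>Stevenson frames for \<open>H = sobolev s\<close>, whose dual is \<open>H' = sobolev (- s)\<close>.\<close>

definition stevenson_frame :: "real \<Rightarrow> 'i set \<Rightarrow> ('i \<Rightarrow> coeffs) \<Rightarrow> bool" where
  "stevenson_frame s I \<psi> \<longleftrightarrow>
     (\<forall>i\<in>I. \<psi> i \<in> sobolev s) \<and>
     (\<exists>A B. 0 < A \<and> A \<le> B \<and>
        (\<forall>g\<in>sobolev (- s).
           (\<lambda>i. (cmod (sobolev_pairing g (\<psi> i)))\<^sup>2) summable_on I \<and>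
           A * (sobolev_norm (- s) g)\<^sup>2 \<le> (\<Sum>\<^sub>\<infinity>i\<in>I. (cmod (sobolev_pairing g (\<psi> i)))\<^sup>2) \<and>
           (\<Sum>\<^sub>\<infinity>i\<in>I. (cmod (sobolev_pairing g (\<psi> i)))\<^sup>2) \<le> B * (sobolev_norm (- s) g)\<^sup>2))"

definition frame_operator :: "real \<Rightarrow> 'i set \<Rightarrow> ('i \<Rightarrow> coeffs) \<Rightarrow> coeffs \<Rightarrow> coeffs" where
  "frame_operator s I \<psi> g =
     (THE h. sobolev_has_sum s (\<lambda>i n. sobolev_pairing g (\<psi> i) * \<psi> i n) I h)"

definition canonical_dual_frame ::
    "real \<Rightarrow> 'i set \<Rightarrow> ('i \<Rightarrow> coeffs) \<Rightarrow> ('i \<Rightarrow> coeffs) \<Rightarrow> bool" where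
  "canonical_dual_frame s I \<psi> \<psi>' \<longleftrightarrow>
     (\<forall>g\<in>sobolev (- s).
        sobolev_has_sum s (\<lambda>i n. sobolev_pairing g (\<psi> i) * \<psi> i n) I (frame_operator s I \<psi> g)) \<and>
     bij_betw (frame_operator s I \<psi>) (sobolev (- s)) (sobolev s) \<and>
     (\<forall>i\<in>I. \<psi>' i = inv_into (sobolev (- s)) (frame_operator s I \<psi>) (\<psi> i))"

section \<open>Wavelets\<close>

definition wavelet_coeff ::
    "(int \<Rightarrow> nat \<Rightarrow> complex) \<Rightarrow> (int \<Rightarrow> 'k \<Rightarrow> real) \<Rightarrow> (int \<Rightarrow> 'k \<Rightarrow> real ^ 3)
      \<Rightarrow> int \<Rightarrow> 'k \<Rightarrow> nat \<Rightarrow> int \<Rightarrow> complex" where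
  "wavelet_coeff \<kappa> w \<Lambda> j k l m =
     complex_of_real (sqrt (4 * pi / (2 * real l + 1)) * sqrt (w j k)) * \<kappa> j l
     * sph_harm l m (\<Lambda> j k)"

definition scalar_wavelet ::
    "(int \<Rightarrow> nat) \<Rightarrow> (int \<Rightarrow> nat \<Rightarrow> complex) \<Rightarrow> (int \<Rightarrow> 'k \<Rightarrow> real) \<Rightarrow> (int \<Rightarrow> 'k \<Rightarrow> real ^ 3)
      \<Rightarrow> int \<times> 'k \<Rightarrow> real ^ 3 \<Rightarrow> complex" where
  "scalar_wavelet L \<kappa> w \<Lambda> = (\<lambda>(j, k) p.
     \<Sum>l\<le>L j. \<Sum>m\<in>{- int l..int l}. wavelet_coeff \<kappa> w \<Lambda> j k l m * sph_harm l m p)"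

text \<open>The weights \<open>1/a\<^sub>l, 1, a\<^sub>l\<close> (degree \<open>r = 0, 1, 2\<close>) of the wavelet forms are the powers
  \<open>a\<^sub>l\<^sup>r\<^sup>-\<^sup>1\<close>, and those of the dual forms their inverses. The terms with \<open>l = 0\<close> vanish
  since \<open>spec_form r \<nu> 0 m\<close> is zero.\<close>

definition wavelet_form ::
    "nat \<Rightarrow> hodge_part \<Rightarrow> (int \<Rightarrow> nat) \<Rightarrow> (int \<Rightarrow> nat \<Rightarrow> complex) \<Rightarrow> (int \<Rightarrow> 'k \<Rightarrow> real)
      \<Rightarrow> (int \<Rightarrow> 'k \<Rightarrow> real ^ 3) \<Rightarrow> int \<times> 'k \<Rightarrow> form" where
  "wavelet_form r \<nu> L \<kappa> w \<Lambda> = (\<lambda>(j, k) p vs.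
     \<Sum>l\<le>L j. \<Sum>m\<in>{- int l..int l}.
       complex_of_real (spec_a l powi (int r - 1)) * wavelet_coeff \<kappa> w \<Lambda> j k l m
       * spec_form r \<nu> l m p vs)"

definition dual_wavelet_form ::
    "nat \<Rightarrow> hodge_part \<Rightarrow> (int \<Rightarrow> nat) \<Rightarrow> (int \<Rightarrow> nat \<Rightarrow> complex) \<Rightarrow> (int \<Rightarrow> 'k \<Rightarrow> real)
      \<Rightarrow> (int \<Rightarrow> 'k \<Rightarrow> real ^ 3) \<Rightarrow> int \<times> 'k \<Rightarrow> form" where
  "dual_wavelet_form r \<nu> L \<kappa> w \<Lambda> = (\<lambda>(j, k) p vs.
     \<Sum>l\<le>L j. \<Sum>m\<in>{- int l..int l}.
       complex_of_real (spec_a l powi (1 - int r)) * wavelet_coeff \<kappa> w \<Lambda> j k l m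
       * spec_form r \<nu> l m p vs)"

end

theory Submission
  imports Defs
begin

text \<open>In the spectral basis, \<open>\<psi>\<^sub>j\<^sub>k\<close> and its dual have the coefficients \<open>a\<^sub>l\<^sup>r\<^sup>-\<^sup>1 \<kappa>\<close> and \<open>a\<^sub>l\<^sup>1\<^sup>-\<^sup>r \<kappa>\<close>, where
  \<open>\<kappa>\<close> are the coefficients of the scalar wavelet. Multiplication by \<open>a\<^sub>l\<^sup>r\<^sup>-\<^sup>1\<close> maps the Sobolev space of order
  \<open>r - 1\<close> isometrically onto \<open>\<ell>\<^sup>2\<close>, and \<open>\<ell>\<^sup>2\<close> onto the one of order \<open>1 - r\<close>, so everything reduces to
  the Parseval identity for \<open>\<kappa>\<close>: the frame bounds are \<open>1\<close> and the frame operator is multiplication by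
  \<open>a\<^sub>l\<^sup>2\<^sup>(\<^sup>r\<^sup>-\<^sup>1\<^sup>)\<close>. The Parseval hypothesis is only applied to finite sums of spherical harmonics; since every
  \<open>\<kappa>\<close> has finite support it extends to \<open>\<ell>\<^sup>2\<close> by density, and completeness of the harmonics is not needed.
  What is needed is that the spectral forms are orthonormal, which is reduced to an identity for
  integrals of polynomials in \<open>cos \<theta>\<close> by means of the Legendre equation.\<close>

section \<open>Parseval families of finitely supported coefficient sequences\<close>

text \<open>Parseval is demanded only for sums over finite \<open>Y\<close>. Since each
  \<open>\<kappa> i\<close> has finite support, statements about square-summable \<open>G\<close>
  reduce to finite sets of coordinates.\<close>

locale parseval_coefficients =
  fixes X :: "'n set" and I :: "'i set" and \<kappa> :: "'i \<Rightarrow> 'n \<Rightarrow> complex"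
  assumes finite_support: "i \<in> I \<Longrightarrow> finite {n \<in> X. \<kappa> i n \<noteq> 0}"
    and finite_parseval: "finite Y \<Longrightarrow> Y \<subseteq> X \<Longrightarrow>
      ((\<lambda>i. (cmod (\<Sum>n\<in>Y. G n * cnj (\<kappa> i n)))\<^sup>2) has_sum (\<Sum>n\<in>Y. (cmod (G n))\<^sup>2)) I"
begin

definition analysis :: "('n \<Rightarrow> complex) \<Rightarrow> 'i \<Rightarrow> complex" where
  "analysis G i = (\<Sum>\<^sub>\<infinity>n\<in>X. G n * cnj (\<kappa> i n))"

lemma analysis_eq_sum:
  assumes "finite Y" "Y \<subseteq> X" "\<And>n. n \<in> X - Y \<Longrightarrow> G n * cnj (\<kappa> i n) = 0"
  shows "analysis G i = (\<Sum>n\<in>Y. G n * cnj (\<kappa> i n))"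
proof -
  have "analysis G i = (\<Sum>\<^sub>\<infinity>n\<in>Y. G n * cnj (\<kappa> i n))"
    unfolding analysis_def by (rule infsum_cong_neutral) (use assms in auto)
  then show ?thesis using assms(1) by simp
qed

lemma analysis_diff:
  assumes "i \<in> I"
  shows "analysis (\<lambda>n. G n - H n) i = analysis G i - analysis H i"
proof -
  let ?Y = "{n \<in> X. \<kappa> i n \<noteq> 0}"
  have *: "analysis G' i = (\<Sum>n\<in>?Y. G' n * cnj (\<kappa> i n))" for G'
    by (rule analysis_eq_sum) (use finite_support[OF assms] in auto)
  show ?thesis unfolding * by (simp add: left_diff_distrib sum_subtractf)
qed

lemma finite_bessel:
  assumes "finite F" "F \<subseteq> I" "finite Y" "Y \<subseteq> X"
  shows "(\<Sum>i\<in>F. (cmod (\<Sum>n\<in>Y. G n * cnj (\<kappa> i n)))\<^sup>2) \<le> (\<Sum>n\<in>Y. (cmod (G n))\<^sup>2)"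
proof -
  have "((\<lambda>i. (cmod (\<Sum>n\<in>Y. G n * cnj (\<kappa> i n)))\<^sup>2) has_sum
      (\<Sum>i\<in>F. (cmod (\<Sum>n\<in>Y. G n * cnj (\<kappa> i n)))\<^sup>2)) F"
    using assms(1) by (rule has_sum_finite)
  then show ?thesis
    by (rule has_sum_mono2[OF _ finite_parseval[OF assms(3,4), of G]]) (use assms in auto)
qed

text \<open>Finitely many \<open>\<kappa> i\<close> see only the finite union \<open>Y\<close> of
  their supports, so \<open>G\<close> may be restricted to \<open>Y\<close>, where the finite case
  applies.\<close>

lemma bessel:
  assumes "finite F" "F \<subseteq> I" "(\<lambda>n. (cmod (G n))\<^sup>2) summable_on X"
  shows "(\<Sum>i\<in>F. (cmod (analysis G i))\<^sup>2) \<le> (\<Sum>\<^sub>\<infinity>n\<in>X. (cmod (G n))\<^sup>2)"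
proof -
  define Y where "Y = (\<Union>i\<in>F. {n \<in> X. \<kappa> i n \<noteq> 0})"
  have Y: "finite Y" "Y \<subseteq> X" using assms finite_support by (auto simp: Y_def)
  have "analysis G i = (\<Sum>n\<in>Y. G n * cnj (\<kappa> i n))" if "i \<in> F" for i
    by (rule analysis_eq_sum[OF Y]) (use that in \<open>auto simp: Y_def\<close>)
  then have "(\<Sum>i\<in>F. (cmod (analysis G i))\<^sup>2) = (\<Sum>i\<in>F. (cmod (\<Sum>n\<in>Y. G n * cnj (\<kappa> i n)))\<^sup>2)"
    by simp
  also have "\<dots> \<le> (\<Sum>n\<in>Y. (cmod (G n))\<^sup>2)"
    by (rule finite_bessel) (use assms Y in auto)
  also have "\<dots> \<le> (\<Sum>\<^sub>\<infinity>n\<in>X. (cmod (G n))\<^sup>2)"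
    by (rule finite_sum_le_infsum) (use assms Y in auto)
  finally show ?thesis .
qed

lemma cmod_diff_square: "(cmod (a - b))\<^sup>2 = (cmod a)\<^sup>2 + ((cmod b)\<^sup>2 - 2 * Re (a * cnj b))"
  unfolding cmod_power2 by (simp add: power2_eq_square algebra_simps)

text \<open>Expand the square. The inner product of \<open>G\<close> and \<open>T\<close> is the sum
  of the squared analysis coefficients over \<open>F\<close>, so it remains to bound the energy of
  \<open>T\<close> by that sum: synthesis is adjoint to analysis, hence also a contraction.\<close>

lemma residual_le:
  assumes "finite F" "F \<subseteq> I" and G: "(\<lambda>n. (cmod (G n))\<^sup>2) summable_on X"
  defines "T \<equiv> \<lambda>n. \<Sum>i\<in>F. analysis G i * \<kappa> i n"
  shows "(\<lambda>n. (cmod (G n - T n))\<^sup>2) summable_on X"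
    and "(\<Sum>\<^sub>\<infinity>n\<in>X. (cmod (G n - T n))\<^sup>2)
      \<le> (\<Sum>\<^sub>\<infinity>n\<in>X. (cmod (G n))\<^sup>2) - (\<Sum>i\<in>F. (cmod (analysis G i))\<^sup>2)"
proof -
  define Y where "Y = (\<Union>i\<in>F. {n \<in> X. \<kappa> i n \<noteq> 0})"
  have Y: "finite Y" "Y \<subseteq> X" using assms finite_support by (auto simp: Y_def)
  have an: "analysis G i = (\<Sum>n\<in>Y. G n * cnj (\<kappa> i n))" if "i \<in> F" for i
    by (rule analysis_eq_sum[OF Y]) (use that in \<open>auto simp: Y_def\<close>)
  have T0: "T n = 0" if "n \<in> X - Y" for n
    unfolding T_def using that by (intro sum.neutral) (auto simp: Y_def)
  \<comment> \<open>The change of the squared modulus at \<open>n\<close> when \<open>T n\<close> is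
    subtracted. It vanishes off \<open>Y\<close>, so its sum is finite.\<close>
  define d where "d n = (cmod (T n))\<^sup>2 - 2 * Re (G n * cnj (T n))" for n
  define t where "t i = (\<Sum>n\<in>Y. T n * cnj (\<kappa> i n))" for i
  \<comment> \<open>Adjointness of analysis and synthesis, used with \<open>G\<close> for the cross
    term and with \<open>T\<close> for the energy of \<open>T\<close>.\<close>
  have pair: "(\<Sum>n\<in>Y. H n * cnj (T n)) = (\<Sum>i\<in>F. (\<Sum>n\<in>Y. H n * cnj (\<kappa> i n)) * cnj (analysis G i))" for H
    unfolding T_def by (simp add: sum_distrib_left sum_distrib_right mult_ac) (rule sum.swap)
  have d: "(d has_sum (\<Sum>n\<in>Y. d n)) X"
  proof -
    have "(d has_sum (\<Sum>n\<in>Y. d n)) Y" using Y(1) by (rule has_sum_finite)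
    then show ?thesis
      by (rule iffD1[OF has_sum_cong_neutral, rotated -1]) (use Y T0 in \<open>auto simp: d_def\<close>)
  qed
  have sq: "(\<lambda>n. (cmod (G n - T n))\<^sup>2) = (\<lambda>n. (cmod (G n))\<^sup>2 + d n)"
    unfolding d_def cmod_diff_square ..
  have hs: "((\<lambda>n. (cmod (G n - T n))\<^sup>2) has_sum ((\<Sum>\<^sub>\<infinity>n\<in>X. (cmod (G n))\<^sup>2) + (\<Sum>n\<in>Y. d n))) X"
    unfolding sq by (intro has_sum_add d) (use G in simp)
  then show "(\<lambda>n. (cmod (G n - T n))\<^sup>2) summable_on X" by (rule has_sum_imp_summable)
  have GT: "(\<Sum>n\<in>Y. Re (G n * cnj (T n))) = (\<Sum>i\<in>F. (cmod (analysis G i))\<^sup>2)"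
    unfolding Re_sum[symmetric] pair
    by (simp add: an[symmetric] cmod_power2 flip: power2_eq_square)
  have TT: "(\<Sum>n\<in>Y. (cmod (T n))\<^sup>2) = (\<Sum>i\<in>F. Re (t i * cnj (analysis G i)))"
    unfolding t_def Re_sum[symmetric] pair[symmetric] by (simp add: cmod_power2 flip: power2_eq_square)
  \<comment> \<open>With \<open>t\<close> the analysis coefficients of \<open>T\<close>, this square
    bounds twice the energy of \<open>T\<close> by the energies of \<open>t\<close> and of
    \<open>analysis G\<close>; the finite Bessel inequality for \<open>T\<close> absorbs that of
    \<open>t\<close>.\<close>
  have "0 \<le> (\<Sum>i\<in>F. (cmod (t i - analysis G i))\<^sup>2)" by (simp add: sum_nonneg)
  also have "\<dots> = (\<Sum>i\<in>F. (cmod (t i))\<^sup>2) + (\<Sum>i\<in>F. (cmod (analysis G i))\<^sup>2) - 2 * (\<Sum>n\<in>Y. (cmod (T n))\<^sup>2)"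
    unfolding cmod_diff_square TT by (simp add: sum.distrib sum_subtractf sum_distrib_left)
  also have "(\<Sum>i\<in>F. (cmod (t i))\<^sup>2) \<le> (\<Sum>n\<in>Y. (cmod (T n))\<^sup>2)"
    unfolding t_def by (rule finite_bessel) (use assms Y in auto)
  finally have "(\<Sum>n\<in>Y. (cmod (T n))\<^sup>2) \<le> (\<Sum>i\<in>F. (cmod (analysis G i))\<^sup>2)" by simp
  then have "(\<Sum>n\<in>Y. d n) \<le> - (\<Sum>i\<in>F. (cmod (analysis G i))\<^sup>2)"
    unfolding d_def sum_subtractf sum_distrib_left[symmetric] GT by simp
  then show "(\<Sum>\<^sub>\<infinity>n\<in>X. (cmod (G n - T n))\<^sup>2)
      \<le> (\<Sum>\<^sub>\<infinity>n\<in>X. (cmod (G n))\<^sup>2) - (\<Sum>i\<in>F. (cmod (analysis G i))\<^sup>2)"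
    using infsumI[OF hs] by simp
qed

text \<open>The upper bound is Bessel. For the lower bound \<open>G\<close> is split into its
  truncation to a finite \<open>Y\<close>, where Parseval is given, and a tail controlled by Bessel;
  the triangle inequality joins the two and \<open>Y\<close> grows to \<open>X\<close>.\<close>

lemma parseval:
  assumes G: "(\<lambda>n. (cmod (G n))\<^sup>2) summable_on X"
  shows "((\<lambda>i. (cmod (analysis G i))\<^sup>2) has_sum (\<Sum>\<^sub>\<infinity>n\<in>X. (cmod (G n))\<^sup>2)) I"
proof -
  let ?E = "\<Sum>\<^sub>\<infinity>i\<in>I. (cmod (analysis G i))\<^sup>2"
  have summable: "(\<lambda>i. (cmod (analysis G i))\<^sup>2) summable_on I"
    by (rule nonneg_bdd_above_summable_on) (use bessel[OF _ _ G] in \<open>auto intro!: bdd_aboveI\<close>)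
  have upper: "?E \<le> (\<Sum>\<^sub>\<infinity>n\<in>X. (cmod (G n))\<^sup>2)"
    using bessel[OF _ _ G] summable by (intro infsum_le_finite_sums) auto
  have Y_bound: "sqrt (\<Sum>n\<in>Y. (cmod (G n))\<^sup>2) \<le>
      sqrt ?E + sqrt ((\<Sum>\<^sub>\<infinity>n\<in>X. (cmod (G n))\<^sup>2) - (\<Sum>n\<in>Y. (cmod (G n))\<^sup>2))"
    if Y: "finite Y" "Y \<subseteq> X" for Y
  proof -
    define H where "H n = (if n \<in> Y then G n else 0)" for n
    define R where "R n = G n - H n" for n
    have aH: "analysis H i = (\<Sum>n\<in>Y. G n * cnj (\<kappa> i n))" for i
      by (subst analysis_eq_sum[OF Y]) (auto simp: H_def)
    have "((\<lambda>n. if n \<in> Y then - (cmod (G n))\<^sup>2 else 0) has_sum (- (\<Sum>n\<in>Y. (cmod (G n))\<^sup>2))) X"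
      by (rule iffD1[OF has_sum_cong_neutral has_sum_finiteI[OF Y(1)]])
        (use Y in \<open>auto simp: sum_negf[symmetric]\<close>)
    then have "((\<lambda>n. (cmod (G n))\<^sup>2 + (if n \<in> Y then - (cmod (G n))\<^sup>2 else 0)) has_sum
       (\<Sum>\<^sub>\<infinity>n\<in>X. (cmod (G n))\<^sup>2) + - (\<Sum>n\<in>Y. (cmod (G n))\<^sup>2)) X"
      by (intro has_sum_add) (use G in simp_all)
    moreover have "(\<lambda>n. (cmod (G n))\<^sup>2 + (if n \<in> Y then - (cmod (G n))\<^sup>2 else 0)) = (\<lambda>n. (cmod (R n))\<^sup>2)"
      by (auto simp: R_def H_def)
    ultimately have R: "((\<lambda>n. (cmod (R n))\<^sup>2) has_sum
       (\<Sum>\<^sub>\<infinity>n\<in>X. (cmod (G n))\<^sup>2) - (\<Sum>n\<in>Y. (cmod (G n))\<^sup>2)) X" by simp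
    have le: "sqrt (\<Sum>i\<in>F. (cmod (\<Sum>n\<in>Y. G n * cnj (\<kappa> i n)))\<^sup>2) \<le>
      sqrt ?E + sqrt ((\<Sum>\<^sub>\<infinity>n\<in>X. (cmod (G n))\<^sup>2) - (\<Sum>n\<in>Y. (cmod (G n))\<^sup>2))" if F: "finite F" "F \<subseteq> I" for F
    proof -
      have "cmod (analysis H i) \<le> cmod (analysis G i) + cmod (analysis R i)" if "i \<in> F" for i
      proof -
        have "analysis H i = analysis G i - analysis R i"
          using analysis_diff[of i G H] F that by (auto simp: R_def[abs_def])
        then show ?thesis by (simp add: norm_triangle_ineq4)
      qed
      then have "L2_set (\<lambda>i. cmod (analysis H i)) F \<le> L2_set (\<lambda>i. cmod (analysis G i) + cmod (analysis R i)) F"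
        by (intro L2_set_mono) auto
      also have "\<dots> \<le> L2_set (\<lambda>i. cmod (analysis G i)) F + L2_set (\<lambda>i. cmod (analysis R i)) F"
        by (rule L2_set_triangle_ineq)
      also have "L2_set (\<lambda>i. cmod (analysis G i)) F \<le> sqrt ?E"
        unfolding L2_set_def using F summable by (intro real_sqrt_le_mono finite_sum_le_infsum) auto
      also have "L2_set (\<lambda>i. cmod (analysis R i)) F \<le> sqrt (\<Sum>\<^sub>\<infinity>n\<in>X. (cmod (R n))\<^sup>2)"
        unfolding L2_set_def using F has_sum_imp_summable[OF R] by (intro real_sqrt_le_mono bessel)
      finally show ?thesis unfolding infsumI[OF R] by (simp add: L2_set_def aH)
    qed
    \<comment> \<open>For fixed \<open>Y\<close>, let \<open>F\<close> exhaust
      \<open>I\<close>.\<close>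
    have "((\<lambda>F. sqrt (\<Sum>i\<in>F. (cmod (\<Sum>n\<in>Y. G n * cnj (\<kappa> i n)))\<^sup>2)) \<longlongrightarrow> sqrt (\<Sum>n\<in>Y. (cmod (G n))\<^sup>2))
      (finite_subsets_at_top I)"
      using finite_parseval[OF Y, of G] unfolding has_sum_def by (rule tendsto_real_sqrt)
    then show ?thesis
      by (rule tendsto_upperbound) (use le in \<open>auto intro: eventually_finite_subsets_at_top_weakI\<close>)
  qed
  have lim: "((\<lambda>Y. \<Sum>n\<in>Y. (cmod (G n))\<^sup>2) \<longlongrightarrow> (\<Sum>\<^sub>\<infinity>n\<in>X. (cmod (G n))\<^sup>2)) (finite_subsets_at_top X)"
    using has_sum_infsum[OF G] unfolding has_sum_def .
  \<comment> \<open>Now \<open>Y\<close> exhausts \<open>X\<close>, and the tail term tends to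
    0.\<close>
  have "((\<lambda>Y. sqrt ?E + sqrt ((\<Sum>\<^sub>\<infinity>n\<in>X. (cmod (G n))\<^sup>2) - (\<Sum>n\<in>Y. (cmod (G n))\<^sup>2))) \<longlongrightarrow>
      sqrt ?E + sqrt ((\<Sum>\<^sub>\<infinity>n\<in>X. (cmod (G n))\<^sup>2) - (\<Sum>\<^sub>\<infinity>n\<in>X. (cmod (G n))\<^sup>2))) (finite_subsets_at_top X)"
    by (intro tendsto_intros lim)
  then have "sqrt (\<Sum>\<^sub>\<infinity>n\<in>X. (cmod (G n))\<^sup>2) \<le>
      sqrt ?E + sqrt ((\<Sum>\<^sub>\<infinity>n\<in>X. (cmod (G n))\<^sup>2) - (\<Sum>\<^sub>\<infinity>n\<in>X. (cmod (G n))\<^sup>2))"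
    by (rule tendsto_le[OF finite_subsets_at_top_neq_bot _ tendsto_real_sqrt[OF lim]])
      (intro eventually_finite_subsets_at_top_weakI Y_bound)
  then have "?E = (\<Sum>\<^sub>\<infinity>n\<in>X. (cmod (G n))\<^sup>2)" using upper by simp
  then show ?thesis using has_sum_infsum[OF summable] by simp
qed

text \<open>The residual energy lies between 0 and the Parseval defect of the partial sum over
  \<open>F\<close>, which tends to 0.\<close>

lemma reconstruction:
  assumes G: "(\<lambda>n. (cmod (G n))\<^sup>2) summable_on X"
  shows "((\<lambda>F. \<Sum>\<^sub>\<infinity>n\<in>X. (cmod (G n - (\<Sum>i\<in>F. analysis G i * \<kappa> i n)))\<^sup>2) \<longlongrightarrow> 0)
    (finite_subsets_at_top I)"
proof (rule tendsto_sandwich[OF _ _ tendsto_const])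
  show "((\<lambda>F. (\<Sum>\<^sub>\<infinity>n\<in>X. (cmod (G n))\<^sup>2) - (\<Sum>i\<in>F. (cmod (analysis G i))\<^sup>2)) \<longlongrightarrow> 0)
      (finite_subsets_at_top I)"
    using parseval[OF G] unfolding has_sum_def by (auto intro!: tendsto_eq_intros)
qed (use residual_le(2)[OF _ _ G] in
    \<open>auto intro!: eventually_finite_subsets_at_top_weakI infsum_nonneg\<close>)

end

section \<open>Legendre polynomials\<close>

text \<open>The power (x^2 - 1)^l solves (x^2 - 1) w' = 2 l x w. Differentiating once gives the case
  n = 0, and each further derivative raises \<open>n\<close> by one.\<close>

lemma rodrigues_ode:
  fixes l n :: nat
  defines "w \<equiv> \<lambda>k. (pderiv ^^ k) ([:-1, 0, 1:] ^ l) :: real poly"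
  shows "[:-1, 0, 1:] * w (n + 2) + smult (2 * (real n + 1 - real l)) ([:0, 1:] * w (n + 1))
    + smult ((real n + 1) * (real n - 2 * real l)) (w n) = 0"
proof (induction n)
  have D: "pderiv (w k) = w (Suc k)" for k by (simp add: w_def)
  {
    case 0
    have "[:-1, 0, 1:] * w 1 = smult (2 * real l) ([:0, 1:] * w 0)"
    proof (cases l)
      case (Suc k)
      define q where "q = ([:-1, 0, 1:] :: real poly)"
      have q': "pderiv q = smult 2 [:0, 1:]" by (simp add: q_def pderiv_pCons)
      show ?thesis unfolding w_def Suc q_def[symmetric]
        by (simp add: pderiv_power_Suc q' del: power_Suc) (simp add: mult_ac smult_add_left)
    qed (simp add: w_def)
    from arg_cong[OF this, of pderiv]
    have "w 1 * [:0, 2:] + [:-1, 0, 1:] * w 2 = smult (2 * real l) (w 0 + [:0, 1:] * w 1)"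
      by (simp only: pderiv_mult pderiv_smult D) (simp add: pderiv_pCons numeral_2_eq_2 algebra_simps)
    then show ?case
      by (simp add: poly_eq_poly_eq_iff[symmetric] fun_eq_iff numeral_2_eq_2 algebra_simps)
  next
    case (Suc n)
    let ?f = "\<lambda>n. [:-1, 0, 1:] * w (n + 2) + smult (2 * (real n + 1 - real l)) ([:0, 1:] * w (n + 1))
      + smult ((real n + 1) * (real n - 2 * real l)) (w n)"
    have "?f (Suc n) = pderiv (?f n)"
      unfolding pderiv_mult pderiv_smult pderiv_add D
      by (simp add: poly_eq_poly_eq_iff[symmetric] fun_eq_iff pderiv_pCons algebra_simps)
    then show ?case unfolding Suc by simp
  }
qed

abbreviation sin2 :: "real poly" where "sin2 \<equiv> [:1, 0, -1:]"

abbreviation dlegendre :: "nat \<Rightarrow> nat \<Rightarrow> real poly" where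
  "dlegendre l m \<equiv> (pderiv ^^ m) (legendre l)"

text \<open>The Legendre equation differentiated m times. Since \<open>legendre l\<close> is itself
  an l-th derivative, this is \<open>rodrigues_ode\<close> at order l + m, where the last
  coefficient is (l + m + 1)(m - l).\<close>

lemma dlegendre_ode:
  "sin2 * dlegendre l (m + 2) - smult (2 * (real m + 1)) ([:0, 1:] * dlegendre l (m + 1))
    = smult (real m * (real m + 1) - real l * (real l + 1)) (dlegendre l m)"
proof -
  define c :: real where "c = 1 / (2 ^ l * fact l)"
  define w where "w k = (pderiv ^^ k) ([:-1, 0, 1:] ^ l :: real poly)" for k
  have *: "dlegendre l k = smult c (w (l + k))" for k
    by (simp add: legendre_def higher_pderiv_smult c_def w_def add.commute[of l] funpow_add)
  have "sin2 * dlegendre l (m + 2) - smult (2 * (real m + 1)) ([:0, 1:] * dlegendre l (m + 1))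
      - smult (real m * (real m + 1) - real l * (real l + 1)) (dlegendre l m)
    = smult (- c) ([:-1, 0, 1:] * w (l + m + 2)
      + smult (2 * (real (l + m) + 1 - real l)) ([:0, 1:] * w (l + m + 1))
      + smult ((real (l + m) + 1) * (real (l + m) - 2 * real l)) (w (l + m)))"
    unfolding * by (simp add: poly_eq_poly_eq_iff[symmetric] fun_eq_iff algebra_simps)
  then show ?thesis unfolding rodrigues_ode[where l = l and n = "l + m", folded w_def] by simp
qed

text \<open>The integral of \<open>p\<close> over [-1, 1] after substituting x = cos \<theta>, kept
  in this form because it is the latitude part of the area integral.\<close>

definition cos_integral :: "real poly \<Rightarrow> real" where
  "cos_integral p = (LBINT t. poly p (cos t) * sin t * indicator {0..pi} t)"

lemma integrable_poly_cos: "integrable lborel (\<lambda>t. poly p (cos t) * sin t * indicator {0..pi} t)"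
proof -
  have "integrable lborel (\<lambda>t. indicator {0..pi} t *\<^sub>R (poly p (cos t) * sin t))"
    by (rule borel_integrable_compact) (auto intro!: continuous_intros)
  then show ?thesis by (simp add: mult_ac)
qed

lemma cos_integral_add: "cos_integral (p + q) = cos_integral p + cos_integral q"
  unfolding cos_integral_def Bochner_Integration.integral_add[OF integrable_poly_cos integrable_poly_cos, symmetric]
  by (simp add: algebra_simps)

lemma cos_integral_smult: "cos_integral (smult c p) = c * cos_integral p"
  unfolding cos_integral_def by (simp add: mult.assoc)

lemma cos_integral_diff: "cos_integral (p - q) = cos_integral p - cos_integral q"
  using cos_integral_add[of p "smult (-1) q"] cos_integral_smult[of "-1" q] by simp

text \<open>The antiderivative in t is - p(cos t). Integration by parts is done below by writing
  integrands through formal derivatives of polynomials.\<close>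

lemma cos_integral_pderiv: "cos_integral (pderiv p) = poly p 1 - poly p (-1)"
proof -
  have "cos_integral (pderiv p) = - poly p (cos pi) - (- poly p (cos 0))"
    unfolding cos_integral_def
    by (rule integral_FTC_Icc_real)
      (auto intro!: derivative_eq_intros DERIV_chain2[OF poly_DERIV] continuous_intros)
  then show ?thesis by simp
qed

text \<open>The latitude part of the L2 product of two harmonics of order \<open>m\<close>, without
  constants: each associated Legendre function contributes a square root of
  \<open>sin2 ^ m\<close>.\<close>

definition legendre_product :: "nat \<Rightarrow> nat \<Rightarrow> nat \<Rightarrow> real" where
  "legendre_product l l' m = cos_integral (sin2 ^ m * dlegendre l m * dlegendre l' m)"

lemma legendre_product_commute: "legendre_product l l' m = legendre_product l' l m"
  by (simp add: legendre_product_def mult_ac)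

text \<open>Integration by parts in self-adjoint form: by \<open>dlegendre_ode\<close>, the
  derivative of \<open>sin2 ^ Suc m * dlegendre l (Suc m)\<close> is a multiple of
  \<open>sin2 ^ m * dlegendre l m\<close>. The boundary term vanishes because \<open>sin2\<close> is
  zero at 1 and -1.\<close>

lemma legendre_product_Suc:
  "legendre_product l l' (Suc m) =
    (real l * (real l + 1) - real m * (real m + 1)) * legendre_product l l' m"
proof -
  let ?u = "dlegendre l" and ?v = "dlegendre l'"
  have q': "pderiv sin2 = smult (-2) [:0, 1:]" by (simp add: pderiv_pCons)
  have "pderiv (sin2 ^ Suc m * ?u (Suc m) * ?v m) =
    sin2 ^ m * (sin2 * ?u (m + 2) - smult (2 * (real m + 1)) ([:0, 1:] * ?u (m + 1))) * ?v m
    + sin2 ^ Suc m * ?u (Suc m) * ?v (Suc m)"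
    unfolding pderiv_mult pderiv_power_Suc q'
    by (simp only: poly_eq_poly_eq_iff[symmetric] fun_eq_iff) (simp add: algebra_simps)
  from arg_cong[OF this, of cos_integral] show ?thesis
    unfolding dlegendre_ode cos_integral_pderiv cos_integral_add legendre_product_def
    by (simp add: cos_integral_smult algebra_simps)
qed

text \<open>By symmetry the product at order 1 is the one at order 0 times the eigenvalue of
  \<open>l\<close>, and also times that of \<open>l'\<close>. The eigenvalues differ, so order 0
  gives zero, and the recurrence carries this upward.\<close>

lemma legendre_product_orthogonal:
  assumes "l \<noteq> l'"
  shows "legendre_product l l' m = 0"
proof (induction m)
  case 0
  have "real l * (real l + 1) * legendre_product l l' 0 = real l' * (real l' + 1) * legendre_product l l' 0"
    using legendre_product_Suc[of l l' 0] legendre_product_Suc[of l' l 0]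
    by (simp add: legendre_product_commute)
  moreover have "real l * (real l + 1) \<noteq> real l' * (real l' + 1)"
  proof -
    have "(real l - real l') * (real l + real l' + 1) \<noteq> 0" using assms by auto
    then show ?thesis by (simp add: algebra_simps)
  qed
  ultimately show ?case by simp
qed (simp add: legendre_product_Suc)

text \<open>The factors of \<open>legendre_product_Suc\<close> split as (l - m)(l + m + 1) and
  telescope to a quotient of factorials.\<close>

lemma legendre_product_fact:
  assumes "m \<le> l"
  shows "legendre_product l l' m = fact (l + m) / fact (l - m) * legendre_product l l' 0"
  using assms
proof (induction m)
  case (Suc m)
  have 1: "(fact (l + Suc m) :: real) = (real l + real m + 1) * fact (l + m)" by (simp add: algebra_simps)
  have 2: "(fact (l - m) :: real) = (real l - real m) * fact (l - Suc m)"
    using Suc.prems by (subst fact_reduce) (auto simp: of_nat_diff)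
  have lam: "real l * (real l + 1) - real m * (real m + 1) = (real l - real m) * (real l + real m + 1)"
    by (simp add: algebra_simps)
  have "real l - real m \<noteq> 0" using Suc.prems by auto
  then have "legendre_product l l' (Suc m) =
      (real l + real m + 1) * fact (l + m) / fact (l - Suc m) * legendre_product l l' 0"
    using Suc unfolding legendre_product_Suc lam 2 by simp
  then show ?case unfolding 1 .
qed simp

text \<open>Since x (1 - x^2)^(l+1) vanishes at both ends, integrating its derivative gives a
  two-term recurrence in \<open>l\<close>.\<close>

lemma cos_integral_sin2_power:
  "cos_integral (sin2 ^ l) = 2 ^ (2 * l + 1) * (fact l)\<^sup>2 / fact (2 * l + 1)"
proof (induction l)
  case 0
  have "cos_integral 1 = cos_integral (pderiv [:0, 1:])" by (simp add: pderiv_pCons pCons_one)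
  then show ?case unfolding cos_integral_pderiv by simp
next
  case (Suc l)
  have q': "pderiv sin2 = smult (-2) [:0, 1:]" by (simp add: pderiv_pCons)
  have "pderiv ([:0, 1:] * sin2 ^ Suc l) =
     smult (2 * real l + 3) (sin2 ^ Suc l) - smult (2 * (real l + 1)) (sin2 ^ l)"
    unfolding pderiv_mult pderiv_power_Suc q'
    by (simp only: poly_eq_poly_eq_iff[symmetric] fun_eq_iff) (simp add: pderiv_pCons algebra_simps)
  from arg_cong[OF this, of cos_integral]
  have "(2 * real l + 3) * cos_integral (sin2 ^ Suc l) = 2 * (real l + 1) * cos_integral (sin2 ^ l)"
    unfolding cos_integral_pderiv by (simp add: cos_integral_smult cos_integral_diff del: power_Suc)
  then have "cos_integral (sin2 ^ Suc l) = 2 * (real l + 1) * cos_integral (sin2 ^ l) / (2 * real l + 3)"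
    by (simp add: eq_divide_eq mult.commute del: power_Suc)
  moreover have "(fact (2 * Suc l + 1) :: real) = (2 * real l + 3) * (2 * (real l + 1)) * fact (2 * l + 1)"
    by (simp add: algebra_simps)
  \<comment> \<open>The remaining algebra, with the factorials replaced by opaque reals
    \<open>f\<close> and \<open>g\<close>.\<close>
  moreover have "2 * x * (2 ^ (2 * l + 1) * f\<^sup>2 / g) / y = 2 ^ (2 * Suc l + 1) * (x * f)\<^sup>2 / (y * (2 * x) * g)"
    if "x \<noteq> 0" for x y f g :: real
    using that by (simp add: power2_eq_square)
  moreover have "(fact (Suc l) :: real) = (real l + 1) * fact l" by simp
  moreover have "real l + 1 \<noteq> 0" by linarith
  ultimately show ?case
    by (simp only: Suc)
qed

text \<open>The polynomial (x^2 - 1)^l is monic of degree 2 l, so differentiating it 2 l times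
  leaves the constant (2 l)!.\<close>

lemma dlegendre_top: "dlegendre l l = [: fact (2 * l) / (2 ^ l * fact l) :]"
proof -
  let ?q = "[:-1, 0, 1:] ^ l :: real poly"
  have deg: "degree ?q = 2 * l" by (simp add: degree_power_eq)
  have "lead_coeff ?q = 1" by (simp add: lead_coeff_power)
  then have c: "coeff ?q (2 * l) = 1" unfolding deg .
  have "(pderiv ^^ (2 * l)) ?q = [: fact (2 * l) :]"
  proof (rule poly_eqI)
    fix k
    show "coeff ((pderiv ^^ (2 * l)) ?q) k = coeff [: fact (2 * l) :] k"
      using deg c by (cases k) (simp_all add: coeff_higher_pderiv pochhammer_fact coeff_eq_0)
  qed
  then show ?thesis
    by (simp add: legendre_def higher_pderiv_smult mult_2 funpow_add)
qed

text \<open>Evaluated at the top order m = l, where both derivatives are constant, and carried back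
  to m = 0 by \<open>legendre_product_fact\<close>.\<close>

lemma legendre_product_0: "legendre_product l l 0 = 2 / (2 * real l + 1)"
proof -
  have "legendre_product l l l = (fact (2 * l) / (2 ^ l * fact l))\<^sup>2 * cos_integral (sin2 ^ l)"
    unfolding legendre_product_def dlegendre_top
    by (simp add: cos_integral_smult[symmetric] power2_eq_square)
  also have "\<dots> = 2 * (fact (2 * l))\<^sup>2 / fact (2 * l + 1)"
    unfolding cos_integral_sin2_power
    by (simp add: field_simps power2_eq_square power_add power_mult)
  also have "\<dots> = fact (2 * l) * (2 / (2 * real l + 1))"
  proof -
    have "2 * f\<^sup>2 / ((2 * x + 1) * f) = f * (2 / (2 * x + 1))" if "x \<ge> 0" "f \<noteq> 0" for x f :: real
      using that by (simp add: power2_eq_square)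
    from this[of "real l" "fact (2 * l)"] show ?thesis by (simp only: mult_2 Suc_eq_plus1[symmetric] fact_Suc) (simp add: add.commute)
  qed
  also have "legendre_product l l l = fact (2 * l) * legendre_product l l 0"
    using legendre_product_fact[of l l l] by (simp only: mult_2) simp
  finally show ?thesis by (metis mult_cancel_left fact_nonzero)
qed

text \<open>The integrand is the \<open>\<theta>\<close>-part of the Dirichlet form of two spherical harmonics of
  the same order \<open>\<plusminus> m\<close>. Subtracting the exact term \<open>(- m x W\<^sup>m u v)'\<close>, with \<open>W = 1 - x\<^sup>2\<close>, turns
  the terms with \<open>W\<^sup>m\<^sup>-\<^sup>1\<close> into a multiple of \<open>W\<^sup>m u v\<close>.\<close>

lemma dirichlet_legendre:
  "cos_integral (sin2 ^ Suc m * dlegendre l (Suc m) * dlegendre l' (Suc m)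
    - smult (real m) ([:0, 1:] * sin2 ^ m * pderiv (dlegendre l m * dlegendre l' m))
    + smult ((real m)\<^sup>2) ([:1, 0, 1:] * sin2 ^ (m - 1) * dlegendre l m * dlegendre l' m))
   = real l * (real l + 1) * legendre_product l l' m" (is "cos_integral ?p = _")
proof -
  define u v where "u = dlegendre l m" and "v = dlegendre l' m"
  have q': "pderiv sin2 = smult (-2) [:0, 1:]" by (simp add: pderiv_pCons)
  define e where "e = smult (- real m) ([:0, 1:] * sin2 ^ m * (u * v))"
  have "?p = pderiv e + sin2 ^ Suc m * dlegendre l (Suc m) * dlegendre l' (Suc m)
     + smult (real m * (real m + 1)) (sin2 ^ m * u * v)"
    unfolding e_def u_def[symmetric] v_def[symmetric]
    \<comment> \<open>For m = 0 the exponent \<open>m - 1\<close> is truncated to 0; the factor m^2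
      makes that term vanish.\<close>
    by (cases m)
      (simp_all only: poly_eq_poly_eq_iff[symmetric] fun_eq_iff pderiv_mult pderiv_smult pderiv_power_Suc q' diff_Suc_1,
       simp_all add: pderiv_pCons pderiv_mult u_def v_def algebra_simps power2_eq_square)
  \<comment> \<open>No boundary term: for m = 0 the coefficient of \<open>e\<close> is zero,
    otherwise \<open>sin2 ^ m\<close> vanishes at both ends.\<close>
  moreover have "cos_integral (pderiv e) = 0"
    unfolding cos_integral_pderiv by (cases m) (simp_all add: e_def)
  ultimately have "cos_integral ?p = legendre_product l l' (Suc m)
      + real m * (real m + 1) * legendre_product l l' m"
    by (simp only: cos_integral_add cos_integral_smult legendre_product_def u_def v_def)
  then show ?thesis unfolding legendre_product_Suc by (simp add: algebra_simps)
qed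

section \<open>Integration over the sphere\<close>

lemma spherical_coords_nth [simp]:
  "spherical_coords \<theta> \<phi> $ 1 = sin \<theta> * cos \<phi>"
  "spherical_coords \<theta> \<phi> $ 2 = sin \<theta> * sin \<phi>"
  "spherical_coords \<theta> \<phi> $ 3 = cos \<theta>"
  by (simp_all add: spherical_coords_def vector_3)

lemma sphere_norm: "p \<in> S2 \<longleftrightarrow> (p $ 1)\<^sup>2 + (p $ 2)\<^sup>2 + (p $ 3)\<^sup>2 = 1"
  by (simp add: norm_eq_sqrt_inner inner_vec_def sum_3 power2_eq_square)

lemma spherical_coords_in_sphere: "spherical_coords \<theta> \<phi> \<in> S2"
proof -
  have "(sin \<theta> * cos \<phi>)\<^sup>2 + (sin \<theta> * sin \<phi>)\<^sup>2 + (cos \<theta>)\<^sup>2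
    = (sin \<theta>)\<^sup>2 * ((sin \<phi>)\<^sup>2 + (cos \<phi>)\<^sup>2) + (cos \<theta>)\<^sup>2"
    by (simp only: power_mult_distrib distrib_left add_ac)
  then show ?thesis unfolding sphere_norm by simp
qed

lemma continuous_spherical_coords [continuous_intros]:
  fixes f g :: "'a :: t2_space \<Rightarrow> real"
  shows "continuous_on S f \<Longrightarrow> continuous_on S g \<Longrightarrow> continuous_on S (\<lambda>x. spherical_coords (f x) (g x))"
proof -
  assume fg: "continuous_on S f" "continuous_on S g"
  have *: "spherical_coords \<theta> \<phi> =
      (\<chi> i. if i = 1 then sin \<theta> * cos \<phi> else if i = 2 then sin \<theta> * sin \<phi> else cos \<theta>)" for \<theta> \<phi>
    by (simp add: vec_eq_iff forall_3)
  show ?thesis unfolding *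
  proof (rule continuous_on_vec_lambda)
    show "continuous_on S (\<lambda>x. if i = 1 then sin (f x) * cos (g x)
        else if i = 2 then sin (f x) * sin (g x) else cos (f x))" for i :: 3
      using fg by (cases "i = 1"; cases "i = 2") (auto intro!: continuous_intros)
  qed
qed

lemma space_sphere_measure: "space sphere_measure = S2"
  by (simp add: sphere_measure_def)

text \<open>A continuous integrand on the compact coordinate rectangle is integrable, so Fubini
  applies. The rectangle enters through indicators in \<open>g\<close>, so that both integrals run
  over all of \<open>lborel\<close>.\<close>

lemma sphere_integral_iterated:
  fixes f :: "real ^ 3 \<Rightarrow> complex"
  assumes f: "continuous_on S2 f"
  defines "g \<equiv> \<lambda>\<theta> \<phi>. indicator {0..pi} \<theta> *\<^sub>R indicator {0..2 * pi} \<phi> *\<^sub>R sin \<theta> *\<^sub>R f (spherical_coords \<theta> \<phi>)"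
  shows "integrable sphere_measure f"
    and "integrable (lborel \<Otimes>\<^sub>M lborel) (\<lambda>(\<theta>, \<phi>). g \<theta> \<phi>)"
    and "(LINT p|sphere_measure. f p) = (LINT \<theta>|lborel. LINT \<phi>|lborel. g \<theta> \<phi>)"
proof -
  let ?R = "{0..pi} \<times> {0..2 * pi} :: (real \<times> real) set"
  let ?M = "restrict_space lborel ?R"
  let ?sc = "\<lambda>(\<theta>, \<phi>). spherical_coords \<theta> \<phi>"
  have R[simp]: "?R \<inter> space lborel \<in> sets lborel" by (simp add: borel_closed closed_Times)
  have f_meas: "f \<in> borel_measurable (restrict_space borel S2)"
    using f by (rule borel_measurable_continuous_on_restrict)
  have sc: "?sc \<in> measurable ?M (restrict_space borel S2)"
    by (rule measurable_restrict_space2)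
      (auto simp: spherical_coords_in_sphere[unfolded mem_sphere dist_0_norm] case_prod_beta intro!: measurable_restrict_space1
        borel_measurable_continuous_onI continuous_intros)
  have sin_meas: "(\<lambda>(\<theta>, \<phi>). sin \<theta>) \<in> borel_measurable ?M"
    by (auto simp: case_prod_beta intro!: measurable_restrict_space1 borel_measurable_continuous_onI continuous_intros)
  have sin_nn: "AE x in ?M. 0 \<le> (case x of (\<theta>, \<phi>) \<Rightarrow> sin \<theta>)"
    by (rule AE_I2) (auto simp: space_restrict_space intro!: sin_ge_zero)
  have dens: "(\<lambda>(\<theta>, \<phi>). ennreal (sin \<theta>)) = (\<lambda>x. ennreal (case x of (\<theta>, \<phi>) \<Rightarrow> sin \<theta>))"
    by auto
  have sc': "?sc \<in> measurable (density ?M (\<lambda>(\<theta>, \<phi>). ennreal (sin \<theta>))) (restrict_space borel S2)"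
    using sc by simp
  have fsc: "(\<lambda>x. f (?sc x)) \<in> borel_measurable ?M"
    using measurable_compose[OF sc f_meas] .
  have g: "indicator ?R x *\<^sub>R (case x of (\<theta>, \<phi>) \<Rightarrow> sin \<theta>) *\<^sub>R f (?sc x) = (\<lambda>(\<theta>, \<phi>). g \<theta> \<phi>) x" for x
    by (auto simp: g_def indicator_def split: prod.splits)
  have int: "integrable lborel (\<lambda>x. indicator ?R x *\<^sub>R (case x of (\<theta>, \<phi>) \<Rightarrow> sin \<theta>) *\<^sub>R f (?sc x))"
  proof (rule borel_integrable_compact)
    have "continuous_on ?R (\<lambda>x. f (spherical_coords (fst x) (snd x)))"
      by (rule continuous_on_compose2[OF f])
        (auto intro!: continuous_intros simp: spherical_coords_in_sphere[unfolded mem_sphere dist_0_norm])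
    then show "continuous_on ?R (\<lambda>x. (case x of (\<theta>, \<phi>) \<Rightarrow> sin \<theta>) *\<^sub>R f (?sc x))"
      by (auto simp: case_prod_beta intro!: continuous_intros)
  qed (auto intro: compact_Times)
  show int': "integrable (lborel \<Otimes>\<^sub>M lborel) (\<lambda>(\<theta>, \<phi>). g \<theta> \<phi>)"
    using int unfolding g lborel_prod .
  show "integrable sphere_measure f"
    unfolding sphere_measure_def integrable_distr_eq[OF sc' f_meas]
    unfolding dens integrable_density[OF fsc sin_meas sin_nn] integrable_restrict_space[OF R]
    using int .
  have "(LINT p|sphere_measure. f p) = (LINT x|lborel. (\<lambda>(\<theta>, \<phi>). g \<theta> \<phi>) x)"
    unfolding sphere_measure_def integral_distr[OF sc' f_meas]
    unfolding dens integral_density[OF fsc sin_meas sin_nn] integral_restrict_space[OF R] g ..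
  also have "\<dots> = (LINT \<theta>|lborel. LINT \<phi>|lborel. g \<theta> \<phi>)"
    using lborel_pair.integral_fst'[OF int'] by (simp add: lborel_prod)
  finally show "(LINT p|sphere_measure. f p) = (LINT \<theta>|lborel. LINT \<phi>|lborel. g \<theta> \<phi>)" .
qed

text \<open>The space of \<open>sphere_measure\<close> is \<open>S2\<close>, so values off the
  sphere do not count. This allows replacing the harmonics by polynomials.\<close>

lemma sphere_cong:
  assumes "\<And>p. p \<in> S2 \<Longrightarrow> f p = (g p :: complex)"
  shows "(LINT p|sphere_measure. f p) = (LINT p|sphere_measure. g p)"
    and "integrable sphere_measure f = integrable sphere_measure g"
    and "f \<in> borel_measurable sphere_measure \<longleftrightarrow> g \<in> borel_measurable sphere_measure"
  using assms by (auto simp: space_sphere_measure intro!: Bochner_Integration.integral_cong Bochner_Integration.integrable_cong measurable_cong simp del: mem_sphere)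

lemma integral_cis:
  "(LINT \<phi>|lborel. indicator {0..2 * pi} \<phi> *\<^sub>R cis (of_int k * \<phi>)) = (if k = 0 then 2 * pi else 0)"
proof (cases "k = 0")
  case False
  define F where "F \<phi> = exp (\<i> * of_int k * of_real \<phi>) / (\<i> * of_int k)" for \<phi> :: real
  have cis: "cis (of_int k * \<phi>) = exp (\<i> * of_int k * of_real \<phi>)" for \<phi>
    by (simp add: cis_conv_exp mult_ac)
  have "(LINT \<phi>|lborel. indicator {0..2 * pi} \<phi> *\<^sub>R cis (of_int k * \<phi>)) = F (2 * pi) - F 0"
  proof (rule integral_FTC_atLeastAtMost)
    show "(F has_vector_derivative cis (of_int k * x)) (at x within {0..2*pi})" for x
      unfolding F_def cis
      by (rule has_vector_derivative_real_field) (use False in \<open>auto intro!: derivative_eq_intros\<close>)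
  qed (auto intro!: continuous_intros)
  also have "\<dots> = 0"
    using cis_multiple_2pi[of "of_int k"] cis[of "2 * pi"] by (simp add: F_def mult_ac)
  finally show ?thesis using False by simp
qed (simp add: scaleR_conv_of_real mult.commute)

text \<open>The longitude integral factors out as a Fourier coefficient, of which only k = 0
  survives. \<open>h\<close> is a function of \<theta> rather than a polynomial in cos \<theta>, as
  harmonics of different orders can leave odd powers of sin \<theta>.\<close>

lemma sphere_integral:
  fixes f :: "real ^ 3 \<Rightarrow> complex"
  assumes "continuous_on S2 f"
    and sep: "\<And>\<theta> \<phi>. \<theta> \<in> {0..pi} \<Longrightarrow> f (spherical_coords \<theta> \<phi>) = of_real (h \<theta>) * cis (of_int k * \<phi>)"
  shows "(LINT p|sphere_measure. f p) =
     of_real ((LINT \<theta>|lborel. h \<theta> * sin \<theta> * indicator {0..pi} \<theta>) * (if k = 0 then 2 * pi else 0))"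
proof -
  have "(LINT p|sphere_measure. f p) = (LINT \<theta>|lborel. LINT \<phi>|lborel.
      of_real (h \<theta> * sin \<theta> * indicator {0..pi} \<theta>) * (indicator {0..2 * pi} \<phi> *\<^sub>R cis (of_int k * \<phi>)))"
    unfolding sphere_integral_iterated(3)[OF assms(1)]
    by (intro Bochner_Integration.integral_cong refl)
      (auto simp: sep indicator_def scaleR_conv_of_real split: if_splits)
  then show ?thesis by (simp only: integral_mult_right_zero integral_cis integral_mult_left_zero integral_complex_of_real)
      (simp only: of_real_mult)
qed

lemma sphere_integral_poly:
  fixes f :: "real ^ 3 \<Rightarrow> complex"
  assumes "continuous_on S2 f"
    and sep: "\<And>\<theta> \<phi>. f (spherical_coords \<theta> \<phi>) = of_real (poly P (cos \<theta>))"
  shows "(LINT p|sphere_measure. f p) = of_real (2 * pi * cos_integral P)"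
  using sphere_integral[OF assms(1), of "\<lambda>\<theta>. poly P (cos \<theta>)" 0] sep
  by (simp add: cos_integral_def)

section \<open>Spherical harmonics as restricted polynomials\<close>

text \<open>The sign is the Condon-Shortley phase when m \<ge> 0; for m < 0 it cancels against the
  sign in \<open>sph_harm\<close>.\<close>

definition harm_const :: "nat \<Rightarrow> int \<Rightarrow> real" where
  "harm_const l m = (if m \<ge> 0 then (-1) ^ nat \<bar>m\<bar> else 1) *
     sqrt ((2 * real l + 1) / (4 * pi) * (fact (l - nat \<bar>m\<bar>) / fact (l + nat \<bar>m\<bar>)))"

abbreviation horizontal :: "int \<Rightarrow> real ^ 3 \<Rightarrow> complex" where
  "horizontal m p \<equiv> of_real (p $ 1) + \<i> * of_int (if m \<ge> 0 then 1 else - 1) * of_real (p $ 2)"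

text \<open>On the sphere, \<open>sqrt (1 - p\<^sub>3\<^sup>2) cis \<phi> = p\<^sub>1 + \<i> p\<^sub>2\<close>, so the harmonics are restrictions of
  polynomials, and in particular smooth at the poles.\<close>

definition sph_poly :: "nat \<Rightarrow> int \<Rightarrow> real ^ 3 \<Rightarrow> complex" where
  "sph_poly l m p =
     of_real (harm_const l m * poly (dlegendre l (nat \<bar>m\<bar>)) (p $ 3)) * horizontal m p ^ nat \<bar>m\<bar>"

lemma sph_harm_eq_sph_poly:
  assumes "p \<in> S2"
  shows "sph_harm l m p = sph_poly l m p"
proof -
  let ?z = "Complex (p $ 1) (p $ 2)"
  have "1 - (p $ 3)\<^sup>2 = (p $ 1)\<^sup>2 + (p $ 2)\<^sup>2"
    using assms unfolding sphere_norm by simp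
  then have "sqrt (1 - (p $ 3)\<^sup>2) = cmod ?z" by (simp add: cmod_def)
  \<comment> \<open>De Moivre in polar form. At the poles \<open>?z\<close> is 0 and the value of
    \<open>Arg\<close> has no influence.\<close>
  then have z: "of_real (sqrt (1 - (p $ 3)\<^sup>2) ^ n) * cis (real n * Arg ?z) = ?z ^ n" for n
    using DeMoivre2[of "cmod ?z" "Arg ?z" n] by (simp add: rcis_cmod_Arg) (simp add: rcis_def)
  have nonneg: "sph_harm_nonneg l n p = of_real ((-1) ^ n *
      sqrt ((2 * real l + 1) / (4 * pi) * (fact (l - n) / fact (l + n))) * poly (dlegendre l n) (p $ 3)) * ?z ^ n" for n
    unfolding z[symmetric] sph_harm_nonneg_def assoc_legendre_def by (simp add: mult_ac)
  show ?thesis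
  proof (cases "m \<ge> 0")
    case True
    moreover have "?z = of_real (p $ 1) + \<i> * of_real (p $ 2)" by (simp add: complex_eq_iff)
    ultimately show ?thesis
      by (simp add: sph_harm_def nonneg sph_poly_def harm_const_def)
  next
    case False
    have "(-1) ^ n * ((-1) ^ n * z) = z" for z :: complex and n
      by (simp add: mult.assoc[symmetric] power_mult_distrib[symmetric])
    moreover have "cnj ?z = of_real (p $ 1) - \<i> * of_real (p $ 2)" by (simp add: complex_eq_iff)
    ultimately show ?thesis using False
      by (simp add: sph_harm_def nonneg sph_poly_def harm_const_def mult.assoc)
  qed
qed

lemma continuous_on_sph_poly [continuous_intros]: "continuous_on S (sph_poly l m)"
  unfolding sph_poly_def[abs_def] by (intro continuous_intros)

lemma horizontal_spherical_coords:
  "horizontal m (spherical_coords \<theta> \<phi>) = of_real (sin \<theta>) * cis (of_int (if m \<ge> 0 then 1 else - 1) * \<phi>)"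
  by (simp add: complex_eq_iff)

lemma cis_power_abs: "cis (of_int (if m \<ge> 0 then 1 else - 1) * \<phi>) ^ nat \<bar>m\<bar> = cis (of_int m * \<phi>)"
proof -
  have "real (nat \<bar>m\<bar>) * (of_int (if m \<ge> 0 then 1 else - 1) * \<phi>) = of_int m * \<phi>" by auto
  then show ?thesis unfolding Complex.DeMoivre by (rule arg_cong)
qed

lemma sph_poly_spherical_coords:
  "sph_poly l m (spherical_coords \<theta> \<phi>) =
    of_real (harm_const l m * poly (dlegendre l (nat \<bar>m\<bar>)) (cos \<theta>) * sin \<theta> ^ nat \<bar>m\<bar>) * cis (of_int m * \<phi>)"
  unfolding sph_poly_def horizontal_spherical_coords power_mult_distrib cis_power_abs by simp

text \<open>The squared constant is inverse to the norm given by
  \<open>legendre_product_fact\<close> and \<open>legendre_product_0\<close>, up to the 2 pi from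
  the longitude.\<close>

lemma harm_const_normalized:
  assumes "\<bar>m\<bar> \<le> int l" "\<bar>m\<bar> \<le> int l'"
  shows "2 * pi * (harm_const l m * harm_const l' m * legendre_product l l' (nat \<bar>m\<bar>)) =
    (if l = l' then 1 else 0)"
proof (cases "l = l'")
  case True
  define n where "n = nat \<bar>m\<bar>"
  have n: "n \<le> l" using assms by (simp add: n_def)
  have "harm_const l m * harm_const l m = (harm_const l m)\<^sup>2" by (simp add: power2_eq_square)
  also have "\<dots> = (2 * real l + 1) / (4 * pi) * (fact (l - n) / fact (l + n))"
    unfolding harm_const_def n_def[symmetric] power_mult_distrib by (simp add: power_even_eq[symmetric] flip: power_mult)
  finally have "2 * pi * (harm_const l m * harm_const l m * legendre_product l l n) =
     2 * pi * ((2 * real l + 1) / (4 * pi) * (fact (l - n) / fact (l + n)) *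
       (fact (l + n) / fact (l - n) * (2 / (2 * real l + 1))))"
    by (simp only: legendre_product_fact[OF n] legendre_product_0)
  also have "\<dots> = 1"
  proof -
    have "2 * pi * (a / (4 * pi) * (b / c) * (c / b * (2 / a))) = 1" if "a \<noteq> 0" "b \<noteq> 0" "c \<noteq> 0" for a b c :: real
      using that by simp
    moreover have "2 * real l + 1 \<noteq> 0" by linarith
    ultimately show ?thesis by simp
  qed
  finally show ?thesis using True by (simp add: n_def)
qed (simp add: legendre_product_orthogonal)

lemma poly_sin2_cos: "poly sin2 (cos \<theta>) = (sin \<theta>)\<^sup>2"
  by (simp add: sin_squared_eq flip: power2_eq_square)

text \<open>Different orders are separated by the longitude integral, equal orders by the Legendre
  products.\<close>

lemma sph_poly_orthonormal:
  assumes "\<bar>m\<bar> \<le> int l" "\<bar>m'\<bar> \<le> int l'"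
  shows "(LINT p|sphere_measure. sph_poly l m p * cnj (sph_poly l' m' p)) = (if (l, m) = (l', m') then 1 else 0)"
proof (cases "m = m'")
  case True
  let ?n = "nat \<bar>m\<bar>"
  have "(LINT p|sphere_measure. sph_poly l m p * cnj (sph_poly l' m' p)) =
    of_real (2 * pi * cos_integral (smult (harm_const l m * harm_const l' m) (sin2 ^ ?n * dlegendre l ?n * dlegendre l' ?n)))"
    unfolding True[symmetric]
    by (rule sphere_integral_poly)
      (auto intro!: continuous_intros simp: sph_poly_spherical_coords poly_sin2_cos cis_cnj cis_mult power_mult_distrib
        power2_eq_square simp del: of_real_power minus_mult_left mult_minus_left poly_pCons)
  also have "\<dots> = of_real (2 * pi * (harm_const l m * harm_const l' m * legendre_product l l' ?n))"
    unfolding cos_integral_smult legendre_product_def ..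
  also have "\<dots> = of_real (if l = l' then 1 else 0)"
    using assms True by (subst harm_const_normalized) auto
  finally show ?thesis using True by simp
next
  case False
  have "(LINT p|sphere_measure. sph_poly l m p * cnj (sph_poly l' m' p)) =
    of_real ((LINT \<theta>|lborel. (harm_const l m * poly (dlegendre l (nat \<bar>m\<bar>)) (cos \<theta>) * sin \<theta> ^ nat \<bar>m\<bar>) *
      (harm_const l' m' * poly (dlegendre l' (nat \<bar>m'\<bar>)) (cos \<theta>) * sin \<theta> ^ nat \<bar>m'\<bar>) * sin \<theta> * indicator {0..pi} \<theta>)
      * (if m - m' = 0 then 2 * pi else 0))"
    by (rule sphere_integral)
      (auto intro!: continuous_intros simp: sph_poly_spherical_coords cis_cnj cis_mult left_diff_distrib
        mult.assoc mult.left_commute[of "cis _"] simp del: of_real_power)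
  then show ?thesis using False by simp
qed

section \<open>Gradients of spherical harmonics\<close>

lemma oriented_frame_cross:
  assumes "oriented_frame p (u, v)"
  shows "p \<in> S2" "p \<bullet> u = 0" "p \<bullet> v = 0" "cross3 p v = - u" "cross3 p u = v" "p \<bullet> cross3 u v = 1"
    "p \<bullet> p = 1"
proof -
  have *: "norm u = 1" "norm v = 1" "u \<bullet> v = 0" "p = cross3 u v"
    using assms by (auto simp: oriented_frame_def)
  show "p \<bullet> u = 0" "p \<bullet> v = 0" unfolding *(4) by (simp_all add: dot_cross_self)
  have np: "(norm p)\<^sup>2 = 1" unfolding *(4) using norm_cross_dot[of u v] *(1-3) by simp
  then show pp: "p \<bullet> p = 1" by (simp add: power2_norm_eq_inner)
  then show "p \<in> S2" "p \<bullet> cross3 u v = 1" unfolding *(4)[symmetric] by (simp_all add: norm_eq_1)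
  have uu: "u \<bullet> u = 1" "v \<bullet> v = 1" using * by (simp_all add: norm_eq_1)
  show "cross3 p u = v"
    unfolding cross_skew[of p u] unfolding *(4) Lagrange *(3) uu by simp
  show "cross3 p v = - u"
    unfolding cross_skew[of p v] unfolding *(4) Lagrange inner_commute[of v u] *(3) uu by simp
qed

text \<open>Normalize a vector orthogonal to \<open>p\<close> and complete it by the cross product.
  Existence makes the choice \<open>SOME e\<close> in \<open>hodge\<close> meaningful.\<close>

lemma oriented_frame_exists:
  assumes "p \<in> S2"
  obtains u v where "oriented_frame p (u, v)"
proof -
  obtain x where x: "x \<noteq> 0" "orthogonal p x"
    using orthogonal_to_vector_exists[of p] by auto
  define u where "u = x /\<^sub>R norm x"
  have u: "norm u = 1" "p \<bullet> u = 0" using x by (auto simp: u_def orthogonal_def)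
  define v where "v = cross3 p u"
  have pp: "p \<bullet> p = 1" "u \<bullet> u = 1" using assms u by (simp_all add: norm_eq_1)
  have "(norm v)\<^sup>2 = 1" using norm_cross_dot[of p u] u assms by (simp add: v_def)
  then have "norm v = 1" using norm_ge_zero[of v] by (auto simp: power2_eq_1_iff simp del: norm_ge_zero)
  moreover have "u \<bullet> v = 0" by (simp add: v_def dot_cross_self)
  moreover have "cross3 u v = p" unfolding v_def Lagrange using u pp by (simp add: inner_commute)
  ultimately show thesis using u by (intro that[of u v]) (simp add: oriented_frame_def)
qed

text \<open>A square matrix with orthonormal rows u, v, p also has orthonormal columns.\<close>

lemma oriented_frame_components:
  assumes "oriented_frame p (u, v)"
  shows "u $ i * u $ j + v $ i * v $ j + p $ i * p $ j = (if i = j then 1 else 0)"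
proof -
  define A :: "real ^ 3 ^ 3" where "A = vector [u, v, p]"
  have A: "A $ 1 = u" "A $ 2 = v" "A $ 3 = p" by (simp_all add: A_def vector_3)
  have "(A ** transpose A) $ a $ b = A $ a \<bullet> A $ b" for a b
    by (simp add: matrix_matrix_mult_def transpose_def inner_vec_def)
  moreover have "u \<bullet> u = 1" "v \<bullet> v = 1" "u \<bullet> v = 0" using assms by (auto simp: oriented_frame_def norm_eq_1)
  ultimately have "A ** transpose A = mat 1"
    using oriented_frame_cross[OF assms]
    by (simp add: vec_eq_iff forall_3 A mat_def inner_commute)
  then have "transpose A ** A = mat 1" by (simp add: matrix_left_right_inverse)
  then have "(transpose A ** A) $ i $ j = (if i = j then 1 else 0)" by (simp add: mat_def)
  then show ?thesis
    by (simp add: matrix_matrix_mult_def transpose_def sum_3 A)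
qed

lemma linear_real3:
  fixes A :: "real ^ 3 \<Rightarrow> complex"
  assumes "linear A"
  shows "A x = of_real (x $ 1) * A (axis 1 1) + of_real (x $ 2) * A (axis 2 1) + of_real (x $ 3) * A (axis 3 1)"
proof -
  have "x = x $ 1 *\<^sub>R axis 1 1 + x $ 2 *\<^sub>R axis 2 1 + x $ 3 *\<^sub>R axis 3 1"
    by (simp add: vec_eq_iff forall_3 axis_def)
  then have "A x = A (x $ 1 *\<^sub>R axis 1 1 + x $ 2 *\<^sub>R axis 2 1 + x $ 3 *\<^sub>R axis 3 1)" by simp
  then show ?thesis
    by (simp only: linear_add[OF assms] linear_scale[OF assms]) (simp only: scaleR_conv_of_real)
qed

text \<open>The sum of such products over an orthonormal basis does not depend on the basis; (u, v,
  p) is compared with the standard one.\<close>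

lemma frame_sum:
  fixes A B :: "real ^ 3 \<Rightarrow> complex"
  assumes "linear A" "linear B" and fr: "oriented_frame p (u, v)"
  shows "A u * cnj (B u) + A v * cnj (B v) = (\<Sum>i\<in>UNIV. A (axis i 1) * cnj (B (axis i 1))) - A p * cnj (B p)"
proof -
  have C: "complex_of_real (u $ i) * of_real (u $ j) + of_real (v $ i) * of_real (v $ j)
      + of_real (p $ i) * of_real (p $ j) = (if i = j then 1 else 0)" for i j
    using arg_cong[OF oriented_frame_components[OF fr, of i j], of complex_of_real] by simp
  define a b where "a i = A (axis i 1)" and "b i = cnj (B (axis i 1))" for i
  have "A x * cnj (B x) = (\<Sum>i\<in>UNIV. \<Sum>j\<in>UNIV. a i * b j * (of_real (x $ i) * of_real (x $ j)))" for x
    unfolding a_def b_def linear_real3[OF assms(1), of x] linear_real3[OF assms(2), of x] sum_3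
    by (simp add: algebra_simps)
  then have "A u * cnj (B u) + A v * cnj (B v) + A p * cnj (B p) =
    (\<Sum>i\<in>UNIV. \<Sum>j\<in>UNIV. a i * b j * (complex_of_real (u $ i) * of_real (u $ j) + of_real (v $ i) * of_real (v $ j)
      + of_real (p $ i) * of_real (p $ j)))"
    by (simp only: sum.distrib distrib_left)
  also have "\<dots> = (\<Sum>i\<in>UNIV. \<Sum>j\<in>UNIV. if i = j then a i * b j else 0)"
    unfolding C by (intro sum.cong refl) auto
  also have "\<dots> = (\<Sum>i\<in>UNIV. a i * b i)" by simp
  finally show ?thesis by (simp add: a_def b_def algebra_simps)
qed

text \<open>The differential of \<open>sph_poly\<close> in the ambient space by the product rule.
  For m = 0 the truncated exponent is harmless because of the factor |m|.\<close>

definition sph_grad :: "nat \<Rightarrow> int \<Rightarrow> real ^ 3 \<Rightarrow> real ^ 3 \<Rightarrow> complex" where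
  "sph_grad l m p v = of_real (harm_const l m) *
     (of_real (poly (dlegendre l (Suc (nat \<bar>m\<bar>))) (p $ 3) * v $ 3) * horizontal m p ^ nat \<bar>m\<bar>
      + of_real (poly (dlegendre l (nat \<bar>m\<bar>)) (p $ 3)) * (of_nat (nat \<bar>m\<bar>) * horizontal m p ^ (nat \<bar>m\<bar> - 1) * horizontal m v))"

text \<open>The tangential projection is the differential of x / |x| at a unit point, so this
  differentiates the radially constant extension used in \<open>ext_deriv0\<close>.\<close>

definition tangential_grad :: "nat \<Rightarrow> int \<Rightarrow> real ^ 3 \<Rightarrow> real ^ 3 \<Rightarrow> complex" where
  "tangential_grad l m p v = sph_grad l m p (v - (p \<bullet> v) *\<^sub>R p)"

lemma linear_sph_grad: "linear (sph_grad l m p)"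
  by (rule linearI; simp only: sph_grad_def vector_add_component vector_scaleR_component)
    (simp_all add: algebra_simps scaleR_conv_of_real)

lemma linear_tangential_grad: "linear (tangential_grad l m p)"
proof -
  have "linear (\<lambda>v. v - (p \<bullet> v) *\<^sub>R p)"
    by (rule linearI) (simp_all add: algebra_simps inner_add_right)
  then show ?thesis
    using linear_compose[OF _ linear_sph_grad] by (auto simp: tangential_grad_def[abs_def] o_def)
qed

lemma sph_poly_has_derivative: "(sph_poly l m has_derivative sph_grad l m p) (at p)"
proof -
  have poly: "((\<lambda>p::real^3. poly q (p $ 3)) has_derivative (\<lambda>v. poly (pderiv q) (p $ 3) * v $ 3)) (at p)" for q :: "real poly"
  proof -
    have "((\<lambda>p::real^3. p $ 3) has_derivative (\<lambda>v. v $ 3)) (at p)"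
      by (rule bounded_linear_imp_has_derivative) (rule bounded_linear_vec_nth)
    from DERIV_compose_FDERIV[OF poly_DERIV this] show ?thesis by (simp add: mult.commute)
  qed
  have hor: "((\<lambda>p. horizontal m p) has_derivative horizontal m) (at p)"
    by (rule linear_imp_has_derivative, rule linearI; simp only: vector_add_component vector_scaleR_component)
      (simp_all add: algebra_simps scaleR_conv_of_real)
  show ?thesis unfolding sph_poly_def[abs_def] sph_grad_def[abs_def]
    by (rule has_derivative_eq_rhs, (rule derivative_intros poly hor)+)
      (auto simp: fun_eq_iff algebra_simps)
qed

lemma ext_deriv0_sph_harm:
  assumes "p \<in> S2"
  shows "ext_deriv0 (sph_harm l m) p [v] = tangential_grad l m p v"
proof -
  have p: "norm p = 1" "p \<noteq> 0" using assms by auto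
  have n: "((\<lambda>x. x /\<^sub>R norm x) has_derivative (\<lambda>v. v - (p \<bullet> v) *\<^sub>R p)) (at p)"
    using p by (auto intro!: derivative_eq_intros has_derivative_norm[OF p(2)] simp: fun_eq_iff inner_commute sgn_div_norm)
  have "((\<lambda>x. sph_poly l m (x /\<^sub>R norm x)) has_derivative tangential_grad l m p) (at p)"
    using diff_chain_at[OF n sph_poly_has_derivative] p
    by (simp add: o_def tangential_grad_def[abs_def])
  \<comment> \<open>After normalizing the argument, harmonic and polynomial agree on the open set of
    nonzero points.\<close>
  then have "((\<lambda>x. sph_harm l m (x /\<^sub>R norm x)) has_derivative tangential_grad l m p) (at p)"
    by (rule has_derivative_transform_within_open[of _ _ _ _ "- {0}"])
      (use p in \<open>auto simp: sph_harm_eq_sph_poly\<close>)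
  then show ?thesis by (simp add: ext_deriv0_def frechet_derivative_at[symmetric])
qed

section \<open>Orthonormality of the spectral forms\<close>

definition form_inner_density :: "form \<Rightarrow> form \<Rightarrow> real ^ 3 \<Rightarrow> complex" where
  "form_inner_density \<alpha> \<beta> p = hodge (wedge \<alpha> (hodge (\<lambda>p vs. cnj (\<beta> p vs)))) p []"

lemma form_inner_eq: "form_inner \<alpha> \<beta> = (LINT p|sphere_measure. form_inner_density \<alpha> \<beta> p)"
  by (simp add: form_inner_def form_integral_def form_inner_density_def)

lemma form_inner_density_sum:
  "form_inner_density (\<lambda>p vs. \<Sum>i\<in>F. c i * \<alpha> i p vs) \<beta> p = (\<Sum>i\<in>F. c i * form_inner_density (\<alpha> i) \<beta> p)"
  by (simp add: form_inner_density_def hodge_def wedge_def sum_distrib_right sum_distrib_left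
      sum.distrib sum_subtractf sum_negf algebra_simps split: prod.split)

text \<open>Both Hodge stars are evaluated in the frame that \<open>hodge\<close> chooses. A
  \<open>form\<close> need not be linear, so the argument - u, coming from p \<times> v = - u, stays
  inside.\<close>

lemma form_inner_density_frame:
  assumes "p \<in> S2"
  obtains u v where "oriented_frame p (u, v)"
    and "\<And>\<alpha> \<beta>. form_inner_density \<alpha> \<beta> p = \<alpha> p [] * cnj (\<beta> p []) - \<alpha> p [u] * cnj (\<beta> p [- u])
      + \<alpha> p [v] * cnj (\<beta> p [v]) + \<alpha> p [u, v] * cnj (\<beta> p [u, v])"
proof -
  define e where "e = (SOME e. oriented_frame p e)"
  obtain u v where e: "e = (u, v)" by (cases e)
  have fr: "oriented_frame p (u, v)"
    unfolding e[symmetric] e_def using oriented_frame_exists[OF assms] by (metis someI_ex)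
  have "(SOME e. oriented_frame p e) = (u, v)" using e e_def by simp
  then have "form_inner_density \<alpha> \<beta> p = \<alpha> p [] * cnj (\<beta> p []) - \<alpha> p [u] * cnj (\<beta> p [- u])
      + \<alpha> p [v] * cnj (\<beta> p [v]) + \<alpha> p [u, v] * cnj (\<beta> p [u, v])" for \<alpha> \<beta>
    using oriented_frame_cross[OF fr]
    by (simp add: form_inner_density_def hodge_def wedge_def)
  with fr show thesis by (rule that)
qed

text \<open>The contraction uses the fixed standard basis instead of a chosen tangent frame, which
  makes it visibly continuous in \<open>p\<close>.\<close>

definition grad_density :: "nat \<Rightarrow> int \<Rightarrow> nat \<Rightarrow> int \<Rightarrow> real ^ 3 \<Rightarrow> complex" where
  "grad_density l m l' m' p =
     (\<Sum>i\<in>UNIV. tangential_grad l m p (axis i 1) * cnj (tangential_grad l' m' p (axis i 1)))"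

text \<open>The projection kills the radial direction, so the term for \<open>p\<close> in
  \<open>frame_sum\<close> vanishes.\<close>

lemma grad_density_frame:
  assumes "oriented_frame p (u, v)"
  shows "grad_density l m l' m' p = tangential_grad l m p u * cnj (tangential_grad l' m' p u)
    + tangential_grad l m p v * cnj (tangential_grad l' m' p v)"
proof -
  have "tangential_grad l m p p = 0"
    using oriented_frame_cross(7)[OF assms] by (simp add: tangential_grad_def linear_0[OF linear_sph_grad])
  then show ?thesis
    unfolding frame_sum[OF linear_tangential_grad linear_tangential_grad assms] by (simp add: grad_density_def)
qed

text \<open>On 1-forms the star rotates the frame by a right angle and only exchanges the two terms
  of the contraction, so exact and co-exact forms have the same density; for degrees 0 and 2 it is
  the scalar product of the harmonics.\<close>

lemma spec_form_density:
  assumes "p \<in> S2" "l \<ge> 1" "l' \<ge> 1" and r\<nu>: "(r, \<nu>) \<in> {(0, Coexact), (1, Exact), (1, Coexact), (2, Exact)}"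
  shows "form_inner_density (spec_form r \<nu> l m) (spec_form r \<nu> l' m') p =
    (if r = 1 then of_real (1 / (spec_a l * spec_a l')) * grad_density l m l' m' p
     else sph_poly l m p * cnj (sph_poly l' m' p))"
proof -
  obtain u v where fr: "oriented_frame p (u, v)"
    and d: "\<And>\<alpha> \<beta>. form_inner_density \<alpha> \<beta> p = \<alpha> p [] * cnj (\<beta> p []) - \<alpha> p [u] * cnj (\<beta> p [- u])
      + \<alpha> p [v] * cnj (\<beta> p [v]) + \<alpha> p [u, v] * cnj (\<beta> p [u, v])"
    using form_inner_density_frame[OF assms(1)] by metis
  note cross = oriented_frame_cross[OF fr]
  note neg = linear_neg[OF linear_tangential_grad]
  have ext: "ext_deriv0 f p [] = 0" "ext_deriv0 f p [x, y] = 0" for f x y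
    by (simp_all add: ext_deriv0_def)
  have hodge_ext: "hodge (ext_deriv0 f) p [] = 0" "hodge (ext_deriv0 f) p [x, y] = 0"
    "hodge (ext_deriv0 f) p [x] = - ext_deriv0 f p [cross3 p x]" for f x y
    by (auto simp: hodge_def ext split: prod.split)
  show ?thesis
    using r\<nu> assms(2,3)
    by (auto simp: d grad_density_frame[OF fr] spec_form_def ext hodge_ext ext_deriv0_sph_harm[OF assms(1)]
        cross neg sph_harm0_def form0_def hodge_def sph_harm_eq_sph_poly[OF assms(1)] algebra_simps)
qed

lemma continuous_on_tangential_grad [continuous_intros]: "continuous_on S (\<lambda>p. tangential_grad l m p v)"
  unfolding tangential_grad_def sph_grad_def by (intro continuous_intros)

lemma continuous_on_grad_density: "continuous_on S (grad_density l m l' m')"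
  unfolding grad_density_def[abs_def] by (intro continuous_intros)

section \<open>Gradients in the coordinate frame of spherical coordinates\<close>

definition e_theta :: "real \<Rightarrow> real \<Rightarrow> real ^ 3" where
  "e_theta \<theta> \<phi> = vector [cos \<theta> * cos \<phi>, cos \<theta> * sin \<phi>, - sin \<theta>]"

definition e_phi :: "real \<Rightarrow> real ^ 3" where
  "e_phi \<phi> = vector [- sin \<phi>, cos \<phi>, 0]"

lemma e_theta_phi_nth [simp]:
  "e_theta \<theta> \<phi> $ 1 = cos \<theta> * cos \<phi>" "e_theta \<theta> \<phi> $ 2 = cos \<theta> * sin \<phi>" "e_theta \<theta> \<phi> $ 3 = - sin \<theta>"
  "e_phi \<phi> $ 1 = - sin \<phi>" "e_phi \<phi> $ 2 = cos \<phi>" "e_phi \<phi> $ 3 = 0"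
  by (simp_all add: e_theta_def e_phi_def vector_3)

lemma oriented_frame_spherical: "oriented_frame (spherical_coords \<theta> \<phi>) (e_theta \<theta> \<phi>, e_phi \<phi>)"
proof -
  have sq: "x * y * (x * y) + x * z * (x * z) = x * x * (y * y + z * z)"
     "x * (y * y) + x * (z * z) = x * (y * y + z * z)"
     "x * (y * y) + z * (x * z) = x * (y * y + z * z)" for x y z :: real
    by (simp_all add: algebra_simps)
  have cs: "cos t * cos t + sin t * sin t = 1" "sin t * sin t + cos t * cos t = 1" for t :: real
    by (simp_all flip: power2_eq_square)
  have "norm (e_theta \<theta> \<phi>) = 1" "norm (e_phi \<phi>) = 1"
    unfolding norm_eq_sqrt_inner inner_vec_def sum_3 by (simp_all add: sq cs)
  moreover have "e_theta \<theta> \<phi> \<bullet> e_phi \<phi> = 0" by (simp add: inner_vec_def sum_3)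
  moreover have "cross3 (e_theta \<theta> \<phi>) (e_phi \<phi>) = spherical_coords \<theta> \<phi>"
    by (simp add: cross_components vec_eq_iff forall_3 mult.assoc sq cs)
  ultimately show ?thesis by (simp add: oriented_frame_def)
qed

text \<open>The \<theta>-derivative of the real amplitude in
  \<open>sph_poly_spherical_coords\<close>.\<close>

definition theta_deriv :: "nat \<Rightarrow> int \<Rightarrow> real \<Rightarrow> real" where
  "theta_deriv l m \<theta> = harm_const l m *
     (of_nat (nat \<bar>m\<bar>) * sin \<theta> ^ (nat \<bar>m\<bar> - 1) * cos \<theta> * poly (dlegendre l (nat \<bar>m\<bar>)) (cos \<theta>)
      - sin \<theta> ^ Suc (nat \<bar>m\<bar>) * poly (dlegendre l (Suc (nat \<bar>m\<bar>))) (cos \<theta>))"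

text \<open>The \<open>\<phi>\<close>-derivative divided by \<open>\<i> sin \<theta>\<close>.\<close>

definition phi_deriv :: "nat \<Rightarrow> int \<Rightarrow> real \<Rightarrow> real" where
  "phi_deriv l m \<theta> = harm_const l m *
     (of_int m * sin \<theta> ^ (nat \<bar>m\<bar> - 1) * poly (dlegendre l (nat \<bar>m\<bar>)) (cos \<theta>))"

lemma tangential_grad_spherical:
  "tangential_grad l m (spherical_coords \<theta> \<phi>) (e_theta \<theta> \<phi>) = of_real (theta_deriv l m \<theta>) * cis (of_int m * \<phi>)"
  "tangential_grad l m (spherical_coords \<theta> \<phi>) (e_phi \<phi>) = \<i> * of_real (phi_deriv l m \<theta>) * cis (of_int m * \<phi>)"
proof -
  note cross = oriented_frame_cross[OF oriented_frame_spherical[of \<theta> \<phi>]]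
  define n where "n = nat \<bar>m\<bar>"
  define s where "s = cis (of_int (if m \<ge> 0 then 1 else - 1) * \<phi>)"
  have s: "s ^ n = cis (of_int m * \<phi>)" unfolding s_def n_def by (rule cis_power_abs)
  have h: "horizontal m (spherical_coords \<theta> \<phi>) = of_real (sin \<theta>) * s"
    unfolding s_def by (rule horizontal_spherical_coords)
  have ht: "horizontal m (e_theta \<theta> \<phi>) = of_real (cos \<theta>) * s"
    by (simp add: s_def complex_eq_iff)
  have hp: "horizontal m (e_phi \<phi>) = \<i> * of_int (if m \<ge> 0 then 1 else - 1) * s"
    by (simp add: s_def complex_eq_iff)
  \<comment> \<open>The factor \<open>of_nat n\<close> covers n = 0, where the exponent
    \<open>n - 1\<close> is truncated.\<close>
  have n: "of_nat n * (s ^ (n - 1) * s) = of_nat n * s ^ n" by (cases n) auto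
  have m: "(of_int m :: complex) = of_int (if m \<ge> 0 then 1 else - 1) * of_nat n"
    by (simp add: n_def)
  have tang: "tangential_grad l m (spherical_coords \<theta> \<phi>) (e_theta \<theta> \<phi>) = sph_grad l m (spherical_coords \<theta> \<phi>) (e_theta \<theta> \<phi>)"
    "tangential_grad l m (spherical_coords \<theta> \<phi>) (e_phi \<phi>) = sph_grad l m (spherical_coords \<theta> \<phi>) (e_phi \<phi>)"
    using cross by (simp_all add: tangential_grad_def)
  show "tangential_grad l m (spherical_coords \<theta> \<phi>) (e_theta \<theta> \<phi>) = of_real (theta_deriv l m \<theta>) * cis (of_int m * \<phi>)"
    unfolding tang sph_grad_def theta_deriv_def s[symmetric] n_def[symmetric] h ht
    using n by (simp add: power_mult_distrib) (auto simp: algebra_simps)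
  show "tangential_grad l m (spherical_coords \<theta> \<phi>) (e_phi \<phi>) = \<i> * of_real (phi_deriv l m \<theta>) * cis (of_int m * \<phi>)"
    unfolding tang sph_grad_def phi_deriv_def s[symmetric] n_def[symmetric] h hp
    using n by (simp add: power_mult_distrib m) (auto simp: algebra_simps)
qed

lemma grad_density_spherical:
  "grad_density l m l' m' (spherical_coords \<theta> \<phi>) =
    of_real (theta_deriv l m \<theta> * theta_deriv l' m' \<theta> + phi_deriv l m \<theta> * phi_deriv l' m' \<theta>) *
    cis (of_int (m - m') * \<phi>)"
proof -
  have "cis (of_int (m - m') * \<phi>) = cis (of_int m * \<phi>) * cis (- (of_int m' * \<phi>))"
    by (simp add: cis_mult left_diff_distrib)
  then show ?thesis
    unfolding grad_density_frame[OF oriented_frame_spherical] tangential_grad_spherical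
    by (simp add: cis_cnj algebra_simps)
qed

text \<open>Green's identity for eigenfunctions of the Laplacian: the Dirichlet form is l (l + 1)
  times the L2 product. For equal orders the density is, up to constants, the polynomial of
  \<open>dirichlet_legendre\<close> at cos \<theta>.\<close>

lemma grad_orthonormal:
  assumes "\<bar>m\<bar> \<le> int l" "\<bar>m'\<bar> \<le> int l'"
  shows "(LINT p|sphere_measure. grad_density l m l' m' p) =
    (if (l, m) = (l', m') then of_nat l * (of_nat l + 1) else 0)"
proof (cases "m = m'")
  case True
  define n where "n = nat \<bar>m\<bar>"
  let ?P = "sin2 ^ Suc n * dlegendre l (Suc n) * dlegendre l' (Suc n)
    - smult (real n) ([:0, 1:] * sin2 ^ n * pderiv (dlegendre l n * dlegendre l' n))
    + smult ((real n)\<^sup>2) ([:1, 0, 1:] * sin2 ^ (n - 1) * dlegendre l n * dlegendre l' n)"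
  have m2: "real_of_int m * real_of_int m = real n * real n"
    unfolding n_def by simp
  have "theta_deriv l m \<theta> * theta_deriv l' m \<theta> + phi_deriv l m \<theta> * phi_deriv l' m \<theta> =
      harm_const l m * harm_const l' m * poly ?P (cos \<theta>)" for \<theta>
  proof -
    let ?c = "cos \<theta>" and ?s = "sin \<theta>"
    define u v u' v' where "u = poly (dlegendre l n) ?c" and "v = poly (dlegendre l' n) ?c"
      and "u' = poly (dlegendre l (Suc n)) ?c" and "v' = poly (dlegendre l' (Suc n)) ?c"
    have ss: "poly (sin2 ^ k) ?c = ?s ^ k * ?s ^ k" for k
      by (simp only: poly_power poly_sin2_cos) (simp add: power2_eq_square power_mult_distrib)
    have P: "poly ?P ?c = ?s ^ Suc n * ?s ^ Suc n * u' * v'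
       - real n * (?c * (?s ^ n * ?s ^ n) * (u * v' + v * u'))
       + (real n)\<^sup>2 * ((1 + ?c * ?c) * (?s ^ (n - 1) * ?s ^ (n - 1)) * u * v)"
      by (simp only: poly_add poly_diff poly_smult poly_mult ss u_def v_def u'_def v'_def pderiv_mult)
        simp
    have n: "real n * (?s ^ (n - 1) * ?s) = real n * ?s ^ n" by (cases n) auto
    have "(real n * ?s ^ (n - 1) * ?c * u - ?s ^ Suc n * u') * (real n * ?s ^ (n - 1) * ?c * v - ?s ^ Suc n * v')
      = (real n)\<^sup>2 * (?c * ?c * (?s ^ (n - 1) * ?s ^ (n - 1)) * u * v)
       - (real n * (?s ^ (n - 1) * ?s)) * (?c * ?s ^ n * (u * v' + v * u'))
       + ?s ^ Suc n * ?s ^ Suc n * u' * v'"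
      by (simp add: algebra_simps power2_eq_square)
    also have "\<dots> = (real n)\<^sup>2 * (?c * ?c * (?s ^ (n - 1) * ?s ^ (n - 1)) * u * v)
       - real n * (?c * (?s ^ n * ?s ^ n) * (u * v' + v * u'))
       + ?s ^ Suc n * ?s ^ Suc n * u' * v'"
      unfolding n by simp
    \<comment> \<open>The \<theta>-derivatives give cos^2 \<theta> where \<open>?P\<close> has 1 +
      cos^2 \<theta>; the missing 1 comes from the \<phi>-derivatives.\<close>
    finally have T: "(real n * ?s ^ (n - 1) * ?c * u - ?s ^ Suc n * u') * (real n * ?s ^ (n - 1) * ?c * v - ?s ^ Suc n * v')
      = poly ?P ?c - (real n)\<^sup>2 * (?s ^ (n - 1) * ?s ^ (n - 1)) * u * v"
      unfolding P by (simp add: algebra_simps)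
    have "theta_deriv l m \<theta> * theta_deriv l' m \<theta> = harm_const l m * harm_const l' m *
       ((real n * ?s ^ (n - 1) * ?c * u - ?s ^ Suc n * u') * (real n * ?s ^ (n - 1) * ?c * v - ?s ^ Suc n * v'))"
      unfolding theta_deriv_def n_def[symmetric] u_def v_def u'_def v'_def by (simp only: mult_ac)
    moreover have "phi_deriv l m \<theta> * phi_deriv l' m \<theta> = harm_const l m * harm_const l' m *
       ((of_int m * of_int m) * (?s ^ (n - 1) * ?s ^ (n - 1)) * u * v)"
      unfolding phi_deriv_def n_def[symmetric] u_def v_def by (simp only: mult_ac)
    ultimately show ?thesis
      unfolding T m2 by (simp only: right_diff_distrib power2_eq_square)
  qed
  then have "grad_density l m l' m (spherical_coords \<theta> \<phi>) =
      of_real (poly (smult (harm_const l m * harm_const l' m) ?P) (cos \<theta>))" for \<theta> \<phi>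
    by (simp only: grad_density_spherical poly_smult diff_self of_int_0 mult_zero_left cis_zero mult_1_right)
  then have "(LINT p|sphere_measure. grad_density l m l' m' p) =
    of_real (2 * pi * cos_integral (smult (harm_const l m * harm_const l' m) ?P))"
    unfolding True[symmetric]
    by (rule sphere_integral_poly[OF continuous_on_grad_density])
  also have "\<dots> = of_real (real l * (real l + 1) * (2 * pi * (harm_const l m * harm_const l' m * legendre_product l l' n)))"
    unfolding cos_integral_smult dirichlet_legendre by (simp only: mult_ac)
  also have "\<dots> = of_real (real l * (real l + 1) * (if l = l' then 1 else 0))"
    using assms True harm_const_normalized[of m l l'] by (simp only: n_def)
  finally show ?thesis using True by simp
next
  case False
  show ?thesis
    unfolding sphere_integral[OF continuous_on_grad_density grad_density_spherical] using False by simp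
qed

text \<open>For 1-forms the two factors \<open>1 / spec_a\<close> cancel the eigenvalue from
  \<open>grad_orthonormal\<close>; the other degrees reduce to
  \<open>sph_poly_orthonormal\<close>.\<close>

lemma spec_form_orthonormal:
  assumes "(l, m) \<in> spec_index" "(l', m') \<in> spec_index"
    and r\<nu>: "(r, \<nu>) \<in> {(0, Coexact), (1, Exact), (1, Coexact), (2, Exact)}"
  shows "form_inner (spec_form r \<nu> l m) (spec_form r \<nu> l' m') = (if (l, m) = (l', m') then 1 else 0)"
    and "integrable sphere_measure (form_inner_density (spec_form r \<nu> l m) (spec_form r \<nu> l' m'))"
proof -
  have l: "l \<ge> 1" "l' \<ge> 1" "\<bar>m\<bar> \<le> int l" "\<bar>m'\<bar> \<le> int l'" using assms by (auto simp: spec_index_def)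
  define g where "g p = (if r = 1 then of_real (1 / (spec_a l * spec_a l')) * grad_density l m l' m' p
     else sph_poly l m p * cnj (sph_poly l' m' p))" for p
  have g: "form_inner_density (spec_form r \<nu> l m) (spec_form r \<nu> l' m') p = g p" if "p \<in> S2" for p
    using spec_form_density[OF that l(1,2) r\<nu>] by (simp only: g_def)
  have "continuous_on S2 g"
    unfolding g_def[abs_def]
    by (cases "r = 1"; simp only: if_True if_False simp_thms)
      (intro continuous_intros continuous_on_grad_density)+
  then show "integrable sphere_measure (form_inner_density (spec_form r \<nu> l m) (spec_form r \<nu> l' m'))"
    using sphere_cong(2)[of "form_inner_density (spec_form r \<nu> l m) (spec_form r \<nu> l' m')" g, OF g]
      sphere_integral_iterated(1) by blast
  have "(LINT p|sphere_measure. g p) = (if (l, m) = (l', m') then 1 else 0)"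
  proof (cases "r = 1")
    case True
    have a: "spec_a l * spec_a l = real l * (real l + 1)" by (simp add: spec_a_def)
    have nz: "real l * (real l + 1) \<noteq> 0" using l by auto
    have N: "complex_of_real (1 / (spec_a l * spec_a l)) * (of_nat l * (of_nat l + 1)) =
        of_real (1 / (real l * (real l + 1)) * (real l * (real l + 1)))"
      unfolding a by (simp only: of_real_mult of_real_add of_real_of_nat_eq of_real_1)
    have "(LINT p|sphere_measure. g p) = of_real (1 / (spec_a l * spec_a l')) *
        (if (l, m) = (l', m') then of_nat l * (of_nat l + 1) else 0)"
      unfolding g_def by (simp only: True if_True simp_thms integral_mult_right_zero grad_orthonormal[OF l(3,4)])
    also have "\<dots> = (if (l, m) = (l', m') then 1 else 0)"
    proof (cases "(l, m) = (l', m')")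
      case True
      then have "l' = l" by simp
      then show ?thesis using True N nz by simp
    qed auto
    finally show ?thesis .
  next
    case False
    then show ?thesis
      unfolding g_def by (simp only: if_False sph_poly_orthonormal[OF l(3,4)])
  qed
  then show "form_inner (spec_form r \<nu> l m) (spec_form r \<nu> l' m') = (if (l, m) = (l', m') then 1 else 0)"
    unfolding form_inner_eq by (subst sphere_cong(1)[OF g])
qed

section \<open>Frames in the homogeneous Sobolev scale\<close>

text \<open>At once the weight of the primal wavelet forms and the square root of the Sobolev weight
  of order r - 1.\<close>

definition sobolev_weight :: "nat \<Rightarrow> nat \<times> int \<Rightarrow> real" where
  "sobolev_weight r n = spec_a (fst n) powi (int r - 1)"

lemma spec_a_pos: "l \<ge> 1 \<Longrightarrow> spec_a l > 0"
  by (simp add: spec_a_def)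

lemma sobolev_weight_pos: "n \<in> spec_index \<Longrightarrow> sobolev_weight r n > 0"
  by (auto simp: sobolev_weight_def spec_index_def spec_a_pos)

lemma sobolev_term_weight:
  assumes "n \<in> spec_index"
  shows "sobolev_term (real r - 1) \<alpha> n = (cmod (of_real (sobolev_weight r n) * \<alpha> n))\<^sup>2"
    and "sobolev_term (1 - real r) \<alpha> n = (cmod (\<alpha> n / of_real (sobolev_weight r n)))\<^sup>2"
proof -
  obtain l m where n: "n = (l, m)" by (cases n)
  let ?x = "real l * (real l + 1)"
  have x: "?x > 0" using assms by (auto simp: n spec_index_def)
  have "(sobolev_weight r n)\<^sup>2 = (spec_a l * spec_a l) powi (int r - 1)"
    unfolding sobolev_weight_def n by (simp only: power_int_mult_distrib power2_eq_square fst_conv)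
  also have "spec_a l * spec_a l = ?x" by (simp add: spec_a_def)
  also have "?x powi (int r - 1) = ?x powr (real r - 1)"
  proof -
    have "?x powr real_of_int (int r - 1) = ?x powi (int r - 1)"
      by (rule powr_real_of_int') (use x in linarith)+
    then show ?thesis by (simp only: of_int_diff of_int_of_nat_eq of_int_1)
  qed
  finally have w: "(sobolev_weight r n)\<^sup>2 = ?x powr (real r - 1)" .
  show "sobolev_term (real r - 1) \<alpha> n = (cmod (of_real (sobolev_weight r n) * \<alpha> n))\<^sup>2"
    unfolding norm_mult power_mult_distrib norm_of_real power2_abs w
    by (simp only: sobolev_term_def n prod.case)
  have e: "?x powr (1 - real r) = 1 / ?x powr (real r - 1)"
    using powr_minus_divide[of ?x "real r - 1"] by simp
  have "sobolev_term (1 - real r) \<alpha> n = 1 / ?x powr (real r - 1) * (cmod (\<alpha> n))\<^sup>2"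
    unfolding sobolev_term_def n prod.case e ..
  then show "sobolev_term (1 - real r) \<alpha> n = (cmod (\<alpha> n / of_real (sobolev_weight r n)))\<^sup>2"
    by (simp add: norm_divide power_divide w)
qed

lemma sobolev_iff:
  "\<alpha> \<in> sobolev (real r - 1) \<longleftrightarrow> (\<forall>n. n \<notin> spec_index \<longrightarrow> \<alpha> n = 0) \<and>
     (\<lambda>n. (cmod (of_real (sobolev_weight r n) * \<alpha> n))\<^sup>2) summable_on spec_index"
  "\<alpha> \<in> sobolev (1 - real r) \<longleftrightarrow> (\<forall>n. n \<notin> spec_index \<longrightarrow> \<alpha> n = 0) \<and>
     (\<lambda>n. (cmod (\<alpha> n / of_real (sobolev_weight r n)))\<^sup>2) summable_on spec_index"
  unfolding sobolev_def mem_Collect_eq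
  by (simp_all only: summable_on_cong[OF sobolev_term_weight(1)] summable_on_cong[OF sobolev_term_weight(2)])

lemma sobolev_norm_weight:
  "sobolev_norm (real r - 1) \<alpha> = sqrt (\<Sum>\<^sub>\<infinity>n\<in>spec_index. (cmod (of_real (sobolev_weight r n) * \<alpha> n))\<^sup>2)"
  "sobolev_norm (1 - real r) \<alpha> = sqrt (\<Sum>\<^sub>\<infinity>n\<in>spec_index. (cmod (\<alpha> n / of_real (sobolev_weight r n)))\<^sup>2)"
  unfolding sobolev_norm_def
  by (simp_all only: infsum_cong[OF sobolev_term_weight(1)] infsum_cong[OF sobolev_term_weight(2)])

lemma finite_support_sobolev:
  assumes "finite {n \<in> spec_index. \<alpha> n \<noteq> 0}" "\<And>n. n \<notin> spec_index \<Longrightarrow> \<alpha> n = 0"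
  shows "\<alpha> \<in> sobolev s"
proof -
  have "sobolev_term s \<alpha> summable_on {n \<in> spec_index. \<alpha> n \<noteq> 0}"
    using assms(1) by (rule summable_on_finite)
  then have "sobolev_term s \<alpha> summable_on spec_index"
    by (rule iffD1[OF summable_on_cong_neutral, rotated -1]) (auto simp: sobolev_term_def)
  then show ?thesis using assms(2) by (simp add: sobolev_def)
qed

text \<open>Keeps the residuals of partial sums in the space, where \<open>sobolev_norm\<close> is
  meaningful.\<close>

lemma sobolev_diff:
  assumes "\<alpha> \<in> sobolev s" "\<beta> \<in> sobolev s"
  shows "(\<lambda>n. \<alpha> n - \<beta> n) \<in> sobolev s"
proof -
  have le: "(cmod (a - b))\<^sup>2 \<le> 2 * (cmod a)\<^sup>2 + 2 * (cmod b)\<^sup>2" for a b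
  proof -
    have "(cmod (a - b))\<^sup>2 \<le> (cmod a + cmod b)\<^sup>2" by (intro power_mono norm_triangle_ineq4) simp
    also have "\<dots> \<le> 2 * (cmod a)\<^sup>2 + 2 * (cmod b)\<^sup>2"
      using sum_squares_ge_zero[of "cmod a - cmod b" 0] by (simp add: power2_eq_square algebra_simps)
    finally show ?thesis .
  qed
  have "(\<lambda>n. 2 * sobolev_term s \<alpha> n + 2 * sobolev_term s \<beta> n) summable_on spec_index"
    using assms by (intro summable_on_add summable_on_cmult_right) (auto simp: sobolev_def)
  then have "sobolev_term s (\<lambda>n. \<alpha> n - \<beta> n) summable_on spec_index"
  proof (rule summable_on_comparison_test)
    fix n :: "nat \<times> int"
    show "sobolev_term s (\<lambda>n. \<alpha> n - \<beta> n) n \<le> 2 * sobolev_term s \<alpha> n + 2 * sobolev_term s \<beta> n"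
      using mult_left_mono[OF le, of "(real (fst n) * (real (fst n) + 1)) powr s" "\<alpha> n" "\<beta> n"]
      by (simp add: sobolev_term_def case_prod_beta algebra_simps)
  qed (simp add: sobolev_term_def case_prod_beta)
  then show ?thesis using assms by (simp add: sobolev_def)
qed

text \<open>One coordinate is bounded by its weight times the Sobolev norm, so norm convergence
  forces convergence of each coefficient.\<close>

lemma sobolev_has_sum_pointwise:
  assumes hs: "sobolev_has_sum (1 - real r) f I \<alpha>"
  shows "((\<lambda>i. f i n) has_sum \<alpha> n) I"
proof (cases "n \<in> spec_index")
  case True
  \<comment> \<open>Without membership the infinite sum in the norm could default to 0 and would
    bound nothing.\<close>
  have mem: "(\<lambda>n. \<alpha> n - (\<Sum>i\<in>F. f i n)) \<in> sobolev (1 - real r)" if "finite F" "F \<subseteq> I" for F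
    using that
  proof (induction F rule: finite_induct)
    case (insert i F)
    then have "(\<lambda>n. (\<alpha> n - (\<Sum>i\<in>F. f i n)) - f i n) \<in> sobolev (1 - real r)"
      using hs insert sobolev_diff[of "\<lambda>n. \<alpha> n - (\<Sum>i\<in>F. f i n)" "1 - real r" "f i"]
      by (simp add: sobolev_has_sum_def)
    moreover have "\<alpha> n - (\<Sum>j\<in>insert i F. f j n) = (\<alpha> n - (\<Sum>i\<in>F. f i n)) - f i n" for n
      using insert.hyps by simp
    ultimately show ?case by (simp only:)
  qed (use hs in \<open>simp add: sobolev_has_sum_def\<close>)
  let ?w = "sobolev_weight r n" and ?N = "\<lambda>F. sobolev_norm (1 - real r) (\<lambda>n. \<alpha> n - (\<Sum>i\<in>F. f i n))"
  have le: "cmod ((\<Sum>i\<in>F. f i n) - \<alpha> n) \<le> ?w * ?N F" if "finite F" "F \<subseteq> I" for F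
  proof -
    let ?d = "\<lambda>n. cmod ((\<alpha> n - (\<Sum>i\<in>F. f i n)) / of_real (sobolev_weight r n))"
    have "(?d n)\<^sup>2 \<le> (\<Sum>\<^sub>\<infinity>n\<in>spec_index. (?d n)\<^sup>2)"
    proof -
      have "(\<lambda>n. (?d n)\<^sup>2) summable_on spec_index" using mem[OF that] unfolding sobolev_iff by blast
      then have "(\<Sum>n\<in>{n}. (?d n)\<^sup>2) \<le> (\<Sum>\<^sub>\<infinity>n\<in>spec_index. (?d n)\<^sup>2)"
        by (rule finite_sum_le_infsum) (use True in auto)
      then show ?thesis by simp
    qed
    then have "?d n \<le> ?N F" unfolding sobolev_norm_weight by (rule real_le_rsqrt)
    then show ?thesis using sobolev_weight_pos[OF True, of r]
      by (simp add: norm_divide norm_minus_commute[of "\<alpha> n"] pos_divide_le_eq mult.commute)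
  qed
  have "((\<lambda>F. ?w * ?N F) \<longlongrightarrow> ?w * 0) (finite_subsets_at_top I)"
    using hs unfolding sobolev_has_sum_def by (intro tendsto_intros) auto
  then have lim: "((\<lambda>F. ?w * ?N F) \<longlongrightarrow> 0) (finite_subsets_at_top I)" by simp
  have "((\<lambda>F. (\<Sum>i\<in>F. f i n) - \<alpha> n) \<longlongrightarrow> 0) (finite_subsets_at_top I)"
    by (rule Lim_null_comparison[OF eventually_finite_subsets_at_top_weakI lim]) (rule le)
  then show ?thesis unfolding has_sum_def by (rule LIM_zero_cancel)
next
  case False
  then have "\<alpha> n = 0" "\<And>i. i \<in> I \<Longrightarrow> f i n = 0"
    using hs unfolding sobolev_has_sum_def sobolev_def by blast+
  then show ?thesis by (simp add: has_sum_0)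
qed

text \<open>Makes the definite description in \<open>frame_operator\<close> well defined.\<close>

lemma sobolev_has_sum_unique:
  "sobolev_has_sum (1 - real r) f I \<alpha> \<Longrightarrow> sobolev_has_sum (1 - real r) f I \<beta> \<Longrightarrow> \<alpha> = \<beta>"
  by (rule ext) (blast intro: has_sum_unique sobolev_has_sum_pointwise)

section \<open>Weighted Parseval coefficients as a Stevenson frame\<close>

locale spectral_parseval = parseval_coefficients spec_index I \<kappa>
  for I :: "'i set" and \<kappa> :: "'i \<Rightarrow> coeffs" +
  fixes r :: nat
  assumes off_index: "n \<notin> spec_index \<Longrightarrow> \<kappa> i n = 0"
begin

abbreviation weight :: "nat \<times> int \<Rightarrow> complex" where "weight n \<equiv> of_real (sobolev_weight r n)"

definition primal :: "'i \<Rightarrow> coeffs" where "primal i n = weight n * \<kappa> i n"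

definition dual :: "'i \<Rightarrow> coeffs" where "dual i n = \<kappa> i n / weight n"

lemma weight_nz: "n \<in> spec_index \<Longrightarrow> weight n \<noteq> 0"
  using sobolev_weight_pos[of n r] by simp

lemma primal_sobolev: "i \<in> I \<Longrightarrow> primal i \<in> sobolev s"
  by (rule finite_support_sobolev, rule finite_subset[OF _ finite_support[of i]])
    (auto simp: primal_def off_index)

lemma dual_sobolev: "i \<in> I \<Longrightarrow> dual i \<in> sobolev s"
  by (rule finite_support_sobolev, rule finite_subset[OF _ finite_support[of i]])
    (auto simp: dual_def off_index)

lemma pairing_primal: "sobolev_pairing g (primal i) = analysis (\<lambda>n. weight n * g n) i"
  unfolding sobolev_pairing_def analysis_def primal_def by (simp add: mult_ac)

lemma pairing_dual: "sobolev_pairing f (dual i) = analysis (\<lambda>n. f n / weight n) i"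
  unfolding sobolev_pairing_def analysis_def dual_def by (simp add: mult_ac)

text \<open>The image of \<open>reconstruction\<close> under multiplication by the weight, an
  isometry from l2 onto the space of order 1 - r.\<close>

lemma synthesis:
  assumes G: "(\<lambda>n. (cmod (G n))\<^sup>2) summable_on spec_index" and off: "\<And>n. n \<notin> spec_index \<Longrightarrow> G n = 0"
  shows "sobolev_has_sum (1 - real r) (\<lambda>i n. analysis G i * primal i n) I (\<lambda>n. weight n * G n)"
  unfolding sobolev_has_sum_def
proof (intro conjI ballI)
  have quot: "weight n * z / weight n = z" if "n \<in> spec_index" for n z
    using weight_nz[OF that] by simp
  show "(\<lambda>n. weight n * G n) \<in> sobolev (1 - real r)"
    unfolding sobolev_iff using off G by (auto simp: quot cong: summable_on_cong)
  show "(\<lambda>n. analysis G i * primal i n) \<in> sobolev (1 - real r)" if "i \<in> I" for i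
    by (rule finite_support_sobolev, rule finite_subset[OF _ finite_support[OF that]])
      (auto simp: primal_def off_index)
  have "sobolev_norm (1 - real r) (\<lambda>n. weight n * G n - (\<Sum>i\<in>F. analysis G i * primal i n)) =
      sqrt (\<Sum>\<^sub>\<infinity>n\<in>spec_index. (cmod (G n - (\<Sum>i\<in>F. analysis G i * \<kappa> i n)))\<^sup>2)" for F
  proof -
    have "weight n * G n - (\<Sum>i\<in>F. analysis G i * primal i n) =
        weight n * (G n - (\<Sum>i\<in>F. analysis G i * \<kappa> i n))" for n
      unfolding primal_def by (simp add: right_diff_distrib sum_distrib_left mult_ac)
    then show ?thesis unfolding sobolev_norm_weight by (simp add: quot cong: infsum_cong)
  qed
  then show "((\<lambda>F. sobolev_norm (1 - real r) (\<lambda>n. weight n * G n - (\<Sum>i\<in>F. analysis G i * primal i n))) \<longlongrightarrow> 0)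
      (finite_subsets_at_top I)"
    using tendsto_real_sqrt[OF reconstruction[OF G]] by simp
qed

lemma stevenson: "stevenson_frame (1 - real r) I primal"
  unfolding stevenson_frame_def
proof (intro conjI ballI exI[of _ 1])
  fix g assume "g \<in> sobolev (- (1 - real r))"
  then have "(\<lambda>n. (cmod (weight n * g n))\<^sup>2) summable_on spec_index" by (simp add: sobolev_iff)
  note hs = parseval[OF this]
  show "(\<lambda>i. (cmod (sobolev_pairing g (primal i)))\<^sup>2) summable_on I"
    unfolding pairing_primal using hs by (rule has_sum_imp_summable)
  have "(\<Sum>\<^sub>\<infinity>i\<in>I. (cmod (sobolev_pairing g (primal i)))\<^sup>2) = (sobolev_norm (- (1 - real r)) g)\<^sup>2"
    unfolding pairing_primal infsumI[OF hs] by (simp add: sobolev_norm_weight infsum_nonneg)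
  then show "1 * (sobolev_norm (- (1 - real r)) g)\<^sup>2 \<le> (\<Sum>\<^sub>\<infinity>i\<in>I. (cmod (sobolev_pairing g (primal i)))\<^sup>2)"
    "(\<Sum>\<^sub>\<infinity>i\<in>I. (cmod (sobolev_pairing g (primal i)))\<^sup>2) \<le> 1 * (sobolev_norm (- (1 - real r)) g)\<^sup>2"
    by simp_all
qed (auto simp: primal_sobolev)

lemma frame_expansion:
  assumes "f \<in> sobolev (1 - real r)"
  shows "sobolev_has_sum (1 - real r) (\<lambda>i n. sobolev_pairing f (dual i) * primal i n) I f"
proof -
  have f: "\<And>n. n \<notin> spec_index \<Longrightarrow> f n = 0" "(\<lambda>n. (cmod (f n / weight n))\<^sup>2) summable_on spec_index"
    using assms unfolding sobolev_iff by blast+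
  \<comment> \<open>Off \<open>spec_index\<close> both sides are 0, whatever the weight is
    there.\<close>
  have "(\<lambda>n. weight n * (f n / weight n)) = f"
    using f(1) weight_nz by (auto simp: fun_eq_iff)
  then show ?thesis unfolding pairing_dual using synthesis[OF f(2)] f(1) by simp
qed

text \<open>One factor \<open>weight n\<close> comes from the pairing with \<open>primal\<close>,
  the other from the synthesis.\<close>

lemma frame_operator_eq:
  assumes "g \<in> sobolev (real r - 1)"
  shows "sobolev_has_sum (1 - real r) (\<lambda>i n. sobolev_pairing g (primal i) * primal i n) I
      (frame_operator (1 - real r) I primal g)"
    and "frame_operator (1 - real r) I primal g = (\<lambda>n. (weight n)\<^sup>2 * g n)"
proof -
  have g: "\<And>n. n \<notin> spec_index \<Longrightarrow> g n = 0" "(\<lambda>n. (cmod (weight n * g n))\<^sup>2) summable_on spec_index"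
    using assms unfolding sobolev_iff by blast+
  have hs: "sobolev_has_sum (1 - real r) (\<lambda>i n. sobolev_pairing g (primal i) * primal i n) I (\<lambda>n. (weight n)\<^sup>2 * g n)"
    unfolding pairing_primal using synthesis[OF g(2)] g(1) by (simp add: power2_eq_square mult.assoc)
  show eq: "frame_operator (1 - real r) I primal g = (\<lambda>n. (weight n)\<^sup>2 * g n)"
    unfolding frame_operator_def
  proof (rule the_equality)
    show "sobolev_has_sum (1 - real r) (\<lambda>i n. sobolev_pairing g (primal i) * primal i n) I (\<lambda>n. (weight n)\<^sup>2 * g n)"
      by (rule hs)
  qed (rule sobolev_has_sum_unique[OF _ hs])
  show "sobolev_has_sum (1 - real r) (\<lambda>i n. sobolev_pairing g (primal i) * primal i n) I
      (frame_operator (1 - real r) I primal g)"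
    using hs unfolding eq .
qed

text \<open>The frame operator multiplies by the squared weight, so its inverse divides by it and
  turns \<open>primal\<close> into \<open>dual\<close>.\<close>

lemma canonical_dual: "canonical_dual_frame (1 - real r) I primal dual"
proof -
  let ?S = "frame_operator (1 - real r) I primal"
  have bij: "bij_betw ?S (sobolev (real r - 1)) (sobolev (1 - real r))"
  proof (rule bij_betw_byWitness[where f' = "\<lambda>h n. h n / (weight n)\<^sup>2"])
    show "\<forall>g\<in>sobolev (real r - 1). (\<lambda>n. ?S g n / (weight n)\<^sup>2) = g"
    proof
      fix g assume g: "g \<in> sobolev (real r - 1)"
      then have "\<And>n. n \<notin> spec_index \<Longrightarrow> g n = 0" unfolding sobolev_iff by blast
      then show "(\<lambda>n. ?S g n / (weight n)\<^sup>2) = g"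
        unfolding frame_operator_eq(2)[OF g] using weight_nz by (fastforce simp: fun_eq_iff)
    qed
    show "?S ` sobolev (real r - 1) \<subseteq> sobolev (1 - real r)"
      using frame_operator_eq(1) by (auto simp: sobolev_has_sum_def)
    have mem: "(\<lambda>n. h n / (weight n)\<^sup>2) \<in> sobolev (real r - 1)" if "h \<in> sobolev (1 - real r)" for h
    proof -
      \<comment> \<open>True for every \<open>n\<close>: where the weight is 0, division by zero
        makes both sides 0.\<close>
      have "weight n * (h n / (weight n)\<^sup>2) = h n / weight n" for n
        by (simp add: power2_eq_square)
      then show ?thesis using that unfolding sobolev_iff by simp
    qed
    then show "(\<lambda>h n. h n / (weight n)\<^sup>2) ` sobolev (1 - real r) \<subseteq> sobolev (real r - 1)" by auto
    show "\<forall>h\<in>sobolev (1 - real r). ?S (\<lambda>n. h n / (weight n)\<^sup>2) = h"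
    proof
      fix h assume h: "h \<in> sobolev (1 - real r)"
      then have "\<And>n. n \<notin> spec_index \<Longrightarrow> h n = 0" unfolding sobolev_iff by blast
      then show "?S (\<lambda>n. h n / (weight n)\<^sup>2) = h"
        unfolding frame_operator_eq(2)[OF mem[OF h]] using weight_nz by (fastforce simp: fun_eq_iff)
    qed
  qed
  have "dual i = inv_into (sobolev (real r - 1)) ?S (primal i)" if "i \<in> I" for i
  proof (rule sym, rule inv_into_f_eq)
    show "inj_on ?S (sobolev (real r - 1))" using bij by (rule bij_betw_imp_inj_on)
    show "dual i \<in> sobolev (real r - 1)" using that by (rule dual_sobolev)
    show "?S (dual i) = primal i"
      unfolding frame_operator_eq(2)[OF dual_sobolev[OF that]]
      by (auto simp: fun_eq_iff dual_def primal_def power2_eq_square)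
  qed
  then show ?thesis
    unfolding canonical_dual_frame_def using bij frame_operator_eq(1) by simp
qed

end

section \<open>Wavelet forms\<close>

lemma spec_form_0:
  assumes "(r, \<nu>) \<in> {(0, Coexact), (1, Exact), (1, Coexact), (2, Exact)}"
  shows "spec_form r \<nu> 0 m = (\<lambda>p vs. 0)"
  using assms
  by (auto simp: spec_form_def sph_harm0_def form0_def hodge_def fun_eq_iff split: list.split prod.split)

text \<open>Linearity of the density in the first form and orthonormality read off the coefficients;
  the terms with l = 0 vanish.\<close>

lemma expansion_spec_sum:
  assumes r\<nu>: "(r, \<nu>) \<in> {(0, Coexact), (1, Exact), (1, Coexact), (2, Exact)}"
  shows "expansion r \<nu> (\<lambda>p vs. \<Sum>l\<le>L. \<Sum>m\<in>{- int l..int l}. c l m * spec_form r \<nu> l m p vs) =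
    (\<lambda>(l, m). if (l, m) \<in> spec_index \<and> l \<le> L then c l m else 0)"
proof (rule ext, clarify)
  fix l' m'
  define F where "F = (SIGMA l:{..L}. {- int l..int l})"
  have fin: "finite F" by (simp add: F_def)
  let ?W = "\<lambda>p vs. \<Sum>l\<le>L. \<Sum>m\<in>{- int l..int l}. c l m * spec_form r \<nu> l m p vs"
  let ?d = "\<lambda>n. form_inner_density (spec_form r \<nu> (fst n) (snd n)) (spec_form r \<nu> l' m')"
  show "expansion r \<nu> ?W (l', m') = (if (l', m') \<in> spec_index \<and> l' \<le> L then c l' m' else 0)"
  proof (cases "(l', m') \<in> spec_index")
    case True
    have W: "?W = (\<lambda>p vs. \<Sum>n\<in>F. c (fst n) (snd n) * spec_form r \<nu> (fst n) (snd n) p vs)"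
      unfolding F_def by (subst sum.Sigma) (auto simp: case_prod_beta)
    have d0: "?d n = (\<lambda>p. 0)" if "n \<notin> spec_index" "n \<in> F" for n
    proof -
      have "fst n = 0" using that by (cases n) (auto simp: F_def spec_index_def)
      \<comment> \<open>The empty sum is the zero form, so its density is 0.\<close>
      then show ?thesis
        using form_inner_density_sum[where F = "{}"] by (simp add: spec_form_0[OF r\<nu>] fun_eq_iff)
    qed
    have int: "integrable sphere_measure (\<lambda>p. c (fst n) (snd n) * ?d n p)" if "n \<in> F" for n
    proof (cases "n \<in> spec_index")
      case n: True
      have "integrable sphere_measure (?d n)"
        using spec_form_orthonormal(2)[OF _ True r\<nu>, of "fst n" "snd n"] n by simp
      then show ?thesis by (rule integrable_mult_right)
    next
      case False
      then show ?thesis using d0[OF False that] by simp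
    qed
    have "form_inner ?W (spec_form r \<nu> l' m') = (\<Sum>n\<in>F. c (fst n) (snd n) * (LINT p|sphere_measure. ?d n p))"
      unfolding form_inner_eq W form_inner_density_sum
      by (subst Bochner_Integration.integral_sum) (use int in simp_all)
    also have "\<dots> = (\<Sum>n\<in>F. if n = (l', m') then c l' m' else 0)"
    proof (rule sum.cong[OF refl])
      fix n assume n: "n \<in> F"
      show "c (fst n) (snd n) * (LINT p|sphere_measure. ?d n p) = (if n = (l', m') then c l' m' else 0)"
      proof (cases "n \<in> spec_index")
        case n: True
        have "(LINT p|sphere_measure. ?d n p) = (if n = (l', m') then 1 else 0)"
          using spec_form_orthonormal(1)[OF _ True r\<nu>, of "fst n" "snd n"] n
          unfolding form_inner_eq by simp
        then show ?thesis by auto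
      next
        case False
        then show ?thesis using d0[OF False n] True by auto
      qed
    qed
    also have "\<dots> = (if (l', m') \<in> F then c l' m' else 0)"
      using fin by simp
    also have "(l', m') \<in> F \<longleftrightarrow> l' \<le> L"
      using True by (auto simp: F_def spec_index_def)
    finally show ?thesis using True by (simp add: expansion_def)
  qed (simp add: expansion_def)
qed

section \<open>Finite sums of scalar spherical harmonics\<close>

abbreviation harm_sum :: "(nat \<times> int \<Rightarrow> complex) \<Rightarrow> (nat \<times> int) set \<Rightarrow> real ^ 3 \<Rightarrow> complex" where
  "harm_sum c Y p \<equiv> \<Sum>n\<in>Y. c n * sph_harm (fst n) (snd n) p"

text \<open>On the sphere the harmonics are the continuous \<open>sph_poly\<close>, which gives
  measurability and integrability; the values follow from orthonormality. This makes
  \<open>harm_sum\<close> admissible as a test function in the Parseval hypothesis.\<close>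

lemma
  assumes Y: "finite Y" "\<And>n. n \<in> Y \<Longrightarrow> \<bar>snd n\<bar> \<le> int (fst n)"
  shows harm_sum_L2: "harm_sum c Y \<in> L2_sphere"
    and harm_sum_inner: "finite Z \<Longrightarrow> (\<And>n. n \<in> Z \<Longrightarrow> \<bar>snd n\<bar> \<le> int (fst n)) \<Longrightarrow>
      L2_inner (harm_sum c Y) (harm_sum d Z) = (\<Sum>n\<in>Y \<inter> Z. c n * cnj (d n))"
    and harm_sum_norm: "(LINT p|sphere_measure. (cmod (harm_sum c Y p))\<^sup>2) = (\<Sum>n\<in>Y. (cmod (c n))\<^sup>2)"
proof -
  let ?P = "\<lambda>c Y p. \<Sum>n\<in>Y. c n * sph_poly (fst n) (snd n) p"
  have P: "harm_sum c Y p = ?P c Y p" if "p \<in> S2" for c Y p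
    by (simp add: sph_harm_eq_sph_poly[OF that])
  have cont: "continuous_on S2 (?P c Y)" for c Y
    by (intro continuous_intros)
  have inner: "L2_inner (harm_sum c Y) (harm_sum d Z) = (\<Sum>n\<in>Y \<inter> Z. c n * cnj (d n))"
    if Z: "finite Z" "\<And>n. n \<in> Z \<Longrightarrow> \<bar>snd n\<bar> \<le> int (fst n)" for d Z
  proof -
    let ?h = "\<lambda>n n' p. sph_poly (fst n) (snd n) p * cnj (sph_poly (fst n') (snd n') p)"
    have int: "integrable sphere_measure (\<lambda>p. c n * cnj (d n') * ?h n n' p)" for n n'
      by (rule sphere_integral_iterated(1)) (intro continuous_intros)
    have "L2_inner (harm_sum c Y) (harm_sum d Z) = (LINT p|sphere_measure. ?P c Y p * cnj (?P d Z p))"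
      unfolding L2_inner_def by (rule sphere_cong(1)) (simp only: P)
    also have "\<dots> = (LINT p|sphere_measure. (\<Sum>n\<in>Y. \<Sum>n'\<in>Z. c n * cnj (d n') * ?h n n' p))"
      by (simp add: sum_product mult_ac)
    also have "\<dots> = (\<Sum>n\<in>Y. \<Sum>n'\<in>Z. c n * cnj (d n') * (LINT p|sphere_measure. ?h n n' p))"
      by (simp only: Bochner_Integration.integral_sum Bochner_Integration.integrable_sum int integral_mult_right_zero)
    also have "\<dots> = (\<Sum>n\<in>Y. \<Sum>n'\<in>Z. if n = n' then c n * cnj (d n) else 0)"
      by (intro sum.cong refl) (use sph_poly_orthonormal Y Z in \<open>auto simp: prod_eq_iff\<close>)
    also have "\<dots> = (\<Sum>n\<in>Y. if n \<in> Z then c n * cnj (d n) else 0)"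
      using Z(1) by simp
    also have "\<dots> = (\<Sum>n\<in>Y \<inter> Z. c n * cnj (d n))"
      using Y(1) by (simp add: sum.inter_restrict)
    finally show ?thesis .
  qed
  then show "finite Z \<Longrightarrow> (\<And>n. n \<in> Z \<Longrightarrow> \<bar>snd n\<bar> \<le> int (fst n)) \<Longrightarrow>
      L2_inner (harm_sum c Y) (harm_sum d Z) = (\<Sum>n\<in>Y \<inter> Z. c n * cnj (d n))" .
  have sq: "complex_of_real ((cmod z)\<^sup>2) = z * cnj z" for z by (rule complex_norm_square)
  have "integrable sphere_measure (\<lambda>p. ?P c Y p * cnj (?P c Y p))"
    by (rule sphere_integral_iterated(1)) (intro continuous_intros)
  then have "integrable sphere_measure (\<lambda>p. harm_sum c Y p * cnj (harm_sum c Y p))"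
    by (subst sphere_cong(2)[of _ "\<lambda>p. ?P c Y p * cnj (?P c Y p)"]) (simp_all only: P)
  then have int: "integrable sphere_measure (\<lambda>p. (cmod (harm_sum c Y p))\<^sup>2)"
    unfolding sq[symmetric] by (simp only: complex_of_real_integrable_eq)
  have "?P c Y \<in> borel_measurable sphere_measure"
    using sphere_integral_iterated(1)[OF cont] by (rule borel_measurable_integrable)
  then have "harm_sum c Y \<in> borel_measurable sphere_measure"
    by (subst sphere_cong(3)[of _ "?P c Y"]) (simp_all only: P)
  with int show "harm_sum c Y \<in> L2_sphere" by (simp add: L2_sphere_def)
  have "complex_of_real (LINT p|sphere_measure. (cmod (harm_sum c Y p))\<^sup>2) = L2_inner (harm_sum c Y) (harm_sum c Y)"
    unfolding L2_inner_def sq[symmetric] by (rule integral_complex_of_real[symmetric])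
  also have "\<dots> = (\<Sum>n\<in>Y. c n * cnj (c n))" using inner[OF Y] by simp
  also have "\<dots> = complex_of_real (\<Sum>n\<in>Y. (cmod (c n))\<^sup>2)" unfolding of_real_sum sq ..
  finally show "(LINT p|sphere_measure. (cmod (harm_sum c Y p))\<^sup>2) = (\<Sum>n\<in>Y. (cmod (c n))\<^sup>2)"
    by (simp only: of_real_eq_iff)
qed

theorem theorem4p8:
  fixes L :: "int \<Rightarrow> nat" and \<kappa> :: "int \<Rightarrow> nat \<Rightarrow> complex"
    and K :: "int \<Rightarrow> 'k::zero set" and w :: "int \<Rightarrow> 'k \<Rightarrow> real" and \<Lambda> :: "int \<Rightarrow> 'k \<Rightarrow> real ^ 3"
    and r :: nat and \<nu> :: hodge_part
  assumes "\<And>j l. j \<ge> -1 \<Longrightarrow> l > L j \<Longrightarrow> \<kappa> j l = 0"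
    and "\<And>j k. j \<ge> -1 \<Longrightarrow> k \<in> K j \<Longrightarrow> \<Lambda> j k \<in> S2"
    and "\<And>j k. j \<ge> -1 \<Longrightarrow> k \<in> K j \<Longrightarrow> w j k > 0"
    and "parseval_frame (SIGMA j:{-1..}. K j) (scalar_wavelet L \<kappa> w \<Lambda>)"
    and "K (-1) = {0}"
    and "\<And>l m. \<bar>m\<bar> \<le> int l \<Longrightarrow> wavelet_coeff \<kappa> w \<Lambda> (-1) 0 l m = (if l = 0 then 1 else 0)"
    and "(r, \<nu>) \<in> {(0, Coexact), (1, Exact), (1, Coexact), (2, Exact)}"
  shows "stevenson_frame (1 - real r) (SIGMA j:{-1..}. K j)
           (\<lambda>i. expansion r \<nu> (wavelet_form r \<nu> L \<kappa> w \<Lambda> i))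
       \<and> canonical_dual_frame (1 - real r) (SIGMA j:{-1..}. K j)
           (\<lambda>i. expansion r \<nu> (wavelet_form r \<nu> L \<kappa> w \<Lambda> i))
           (\<lambda>i. expansion r \<nu> (dual_wavelet_form r \<nu> L \<kappa> w \<Lambda> i))
       \<and> (\<forall>f\<in>sobolev (1 - real r).
            sobolev_has_sum (1 - real r)
              (\<lambda>i n. sobolev_pairing f (expansion r \<nu> (dual_wavelet_form r \<nu> L \<kappa> w \<Lambda> i))
                     * expansion r \<nu> (wavelet_form r \<nu> L \<kappa> w \<Lambda> i) n)
              (SIGMA j:{-1..}. K j) f)"
proof -
  let ?I = "SIGMA j:{-1..}. K j"
  define C where "C i n = wavelet_coeff \<kappa> w \<Lambda> (fst i) (snd i) (fst n) (snd n)" for i :: "int \<times> 'k" and n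
  \<comment> \<open>The coefficients of the scalar wavelet with the l = 0 term removed.\<close>
  define k where "k i n = (if n \<in> spec_index \<and> fst n \<le> L (fst i) then C i n else 0)" for i :: "int \<times> 'k" and n
  define Z where "Z i = (SIGMA l:{..L (fst i)}. {- int l..int l})" for i :: "int \<times> 'k"
  have Z: "finite (Z i)" "\<And>n. n \<in> Z i \<Longrightarrow> \<bar>snd n\<bar> \<le> int (fst n)" for i by (auto simp: Z_def)
  have scalar: "scalar_wavelet L \<kappa> w \<Lambda> i = harm_sum (C i) (Z i)" for i
    unfolding Z_def C_def scalar_wavelet_def
    by (rule ext, simp only: case_prod_beta, subst sum.Sigma) (auto simp: case_prod_beta)
  interpret spectral_parseval ?I k r
  proof
    fix i
    show "finite {n \<in> spec_index. k i n \<noteq> 0}"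
      by (rule finite_subset[OF _ Z(1)[of i]]) (auto simp: k_def Z_def spec_index_def split: if_splits)
    show "k i n = 0" if "n \<notin> spec_index" for n using that by (simp add: k_def)
  next
    fix Y :: "(nat \<times> int) set" and G
    assume Y: "finite Y" "Y \<subseteq> spec_index"
    then have Y': "\<And>n. n \<in> Y \<Longrightarrow> \<bar>snd n\<bar> \<le> int (fst n)" by (auto simp: spec_index_def)
    have "L2_inner (harm_sum G Y) (scalar_wavelet L \<kappa> w \<Lambda> i) = (\<Sum>n\<in>Y. G n * cnj (k i n))" for i
    proof -
      have "L2_inner (harm_sum G Y) (scalar_wavelet L \<kappa> w \<Lambda> i) = (\<Sum>n\<in>Y \<inter> Z i. G n * cnj (C i n))"
        unfolding scalar by (rule harm_sum_inner[OF Y(1) Y' Z])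
      \<comment> \<open>\<open>Y\<close> lies in \<open>spec_index\<close>, so the removed l = 0
        term does not enter the pairing.\<close>
      also have "\<dots> = (\<Sum>n\<in>Y. G n * cnj (k i n))"
        unfolding sum.inter_restrict[OF Y(1)]
        by (rule sum.cong) (use Y(2) in \<open>auto simp: k_def Z_def spec_index_def\<close>)
      finally show ?thesis .
    qed
    moreover have "((\<lambda>i. (cmod (L2_inner (harm_sum G Y) (scalar_wavelet L \<kappa> w \<Lambda> i)))\<^sup>2) has_sum
        (LINT p|sphere_measure. (cmod (harm_sum G Y p))\<^sup>2)) ?I"
      using assms(4) harm_sum_L2[OF Y(1) Y'] unfolding parseval_frame_def by blast
    ultimately show "((\<lambda>i. (cmod (\<Sum>n\<in>Y. G n * cnj (k i n)))\<^sup>2) has_sum (\<Sum>n\<in>Y. (cmod (G n))\<^sup>2)) ?I"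
      by (simp only: harm_sum_norm[OF Y(1) Y'])
  qed
  have primal: "(\<lambda>i. expansion r \<nu> (wavelet_form r \<nu> L \<kappa> w \<Lambda> i)) = primal"
    unfolding wavelet_form_def case_prod_beta expansion_spec_sum[OF assms(7)]
    by (auto simp: fun_eq_iff primal_def k_def C_def sobolev_weight_def)
  have "spec_a l powi (1 - int r) = 1 / spec_a l powi (int r - 1)" for l
    using power_int_minus_divide[of "spec_a l" "int r - 1"] by simp
  then have dual: "(\<lambda>i. expansion r \<nu> (dual_wavelet_form r \<nu> L \<kappa> w \<Lambda> i)) = dual"
    unfolding dual_wavelet_form_def case_prod_beta expansion_spec_sum[OF assms(7)]
    by (auto simp: fun_eq_iff dual_def k_def C_def sobolev_weight_def)
  show ?thesis
    unfolding primal dual using stevenson canonical_dual frame_expansion by (simp add: fun_cong[OF primal] fun_cong[OF dual])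
qed

end
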